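(* Let $T$ be a self-similar interval exchange map with associated substitution $\sigma$ and matrix $M$. Assume that $M$ has an eigenvalue $\beta$ with $|\beta|>1$ such that $\beta_0=\beta/|\beta|$ is not a root of unity, and that there exists an eigenvector $\Gamma$ of $M$ for $\beta$ such that $T$ has the unique representation property for $\beta$ and $\Gamma$. Then the map $H$ (associated with $\beta$ and $\Gamma$) has finitely many minimal components, and its restriction to each minimal component is an interval exchange map.
   Context: **Self-similar i.e.m. and substitution.** Let $I=[0,1)$ and $\mathcal A$ a finite alphabet. An interval exchange map (i.e.m.) is a bijection $T\colon I\to I$ such that, for a partition $(I_a)_{a\in\mathcal A}$ of $I$ into (left-closed, right-open) intervals and a vector $\delta\in\mathbb R^{\mathcal A}$, $T(t)=t+\delta_a$ for $t\in I_a$. $T$ is self-similar (on $[0,\alpha)$, $0<\alpha<1$) if its first return map to $[0,\alpha)$ equals $T$ up to rescaling; it exchanges the intervals $I^{(1)}_a=\alpha I_a$, and $r_a$ is the first return time of $I_a^{(1)}$ to $[0,\alpha)$. The associated substitution $\sigma\colon\mathcal A\to\mathcal A^*\setminus\{\varepsilon\}$ ($\mathcal A^*$: finite words, $\varepsilon$: empty word) is given by $\sigma(a)=w_0\dots w_{r_a-1}$ where $T^m(I^{(1)}_a)\subseteq I_{w_m}$ for $0\le m\le r_a-1$ (it is part of the setting that this makes sense). $T$ is minimal and $\sigma$ is primitive. $M$ is the $\mathcal A\times\mathcal A$ matrix with $M_{a,b}$ = number of occurrences of $b$ in $\sigma(a)$. **Fractals.** For $w=w_0\dots w_{n-1}\in\mathcal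 A^*$ put $\Gamma(w)=\Gamma_{w_0}+\dots+\Gamma_{w_{n-1}}$. Let $\bar{\mathcal A}_a=\{(p,c,s)\in\mathcal A^*\times\mathcal A\times\mathcal A^*:\sigma(a)=pcs\}$ and $\bar{\mathcal A}=\bigcup_a\bar{\mathcal A}_a$ (labels). Let $\mathcal S_a$ be the set of sequences $x=(p^x_m,c^x_m,s^x_m)_{m\ge1}\in\bar{\mathcal A}^{\mathbb N}$ with $(p^x_1,c^x_1,s^x_1)\in\bar{\mathcal A}_a$ and $(p^x_{m+1},c^x_{m+1},s^x_{m+1})\in\bar{\mathcal A}_{c^x_m}$ for $m\ge1$; let $\mathcal S_{a,(p,c,s)}$ be those with first coordinate $(p,c,s)$. Put $z_a(x)=\sum_{m\ge1}\beta^{-m}\Gamma(p^x_m)$, $F_a=z_a(\mathcal S_a)$, $F_{a,(p,c,s)}=z_a(\mathcal S_{a,(p,c,s)})$ (compact subsets of $\mathbb C$). For $\tau\in\mathbb S^1$ (unit circle in $\mathbb C$) let $v_a(\tau)=\min_{z\in F_a}\mathrm{Re}(\tau z)$ and $v_{a,(p,c,s)}(\tau)=\min_{z\in F_{a,(p,c,s)}}\mathrm{Re}(\tau z)$. A point $z\in F_a$ is extreme for the direction $\tau$ if $\mathrm{Re}(\tau z)=v_a(\tau)$. **Unique representation property (u.r.p.)** for $\beta$ and $\Gamma$: for every $a\in\mathcal A$ and every extreme point $z\in F_a$ (for any direction) there is a unique $x\in\mathcal S_a$ with $z_a(x)=z$. **The map $H$.** Let $X=\mathbb S^1\times\bar{\mathcal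 A}$ and $H\colon X\to X$, $H(\tau,(q,a,r))=(\beta_0^{-1}\tau,(p,c,s))$, where $(p,c,s)\in\bar{\mathcal A}_a$ satisfies $v_a(\tau)=v_{a,(p,c,s)}(\tau)$. Under the u.r.p. the choice of $(p,c,s)$ is ambiguous for only finitely many $\tau$, and there it is made so that $H$ is right-continuous. **Minimal components.** Split $I=[0,1)$ into $|\bar{\mathcal A}|$ consecutive left-closed right-open intervals $I_{(p,c,s)}$ of equal length, one per label, and identify $\mathbb S^1\times\{(p,c,s)\}$ with $I_{(p,c,s)}$ by the orientation-preserving linear bijection sending $1\in\mathbb S^1$ to the left endpoint. Under this identification $H$ becomes a map $H\colon I\to I$ that is a translation on each of finitely many intervals. Let $\tilde H(t)=\lim_{s\nearrow t}H(s)$ be its left-continuous version, $D$ the set of discontinuities of $H$ together with their preimages and images by (iterates of) $\tilde H$, and $\hat I=I\cup\{t^-:t\in D\}\cup\{1\}$, where $t^-$ is a new point placed immediately to the left of $t$, with the order topology (compact metrizable). Let $\hat H\colon\hat I\to\hat I$ be the continuous map with $\hat H=H$ on $I$, $\hat H(t^-)=(\tilde H(t))^-$ for $t\in D$, and $\hat H(1)$ defined by continuity. A minimal component of $\hat H$ is a nonempty closed set $\hat J\subseteq \hat I$ with $\hat H(\hat J)=\hat J$ in which every point has dense $\hat H$-orbit. A minimal component of $H$ is a set $J=\hat J\cap I$ with $\hat J$ a minimal component of $\hat H$ (or the corresponding subset of $X$). That the restriction of $H$ to a minimal component $J$ is an i.e.m. means: $J$ is a finite union of intervals and $H|_J\colon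 J\to J$ is a bijection which is a translation on each of finitely many intervals partitioning $J$. *)

theory Defs
  imports "HOL-Analysis.Analysis" "HOL-Library.Disjoint_Sets"
begin

section \<open>Self-similar interval exchange maps\<close>

abbreviation unit_ivl :: "real set" where
  "unit_ivl \<equiv> {0..<1}"

text \<open>Maps of [0,1) are functions on all reals; only their values on [0,1) matter.\<close>

definition iem :: "(real \<Rightarrow> real) \<Rightarrow> ('a::finite \<Rightarrow> real set) \<Rightarrow> ('a \<Rightarrow> real) \<Rightarrow> bool" where
  "iem T Iv \<delta> \<longleftrightarrow>
     (\<forall>a. \<exists>l r. l < r \<and> Iv a = {l..<r}) \<and>
     disjoint_family Iv \<and> (\<Union>a. Iv a) = unit_ivl \<and>
     (\<forall>a. \<forall>t\<in>Iv a. T t = t + \<delta> a) \<and>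
     bij_betw T unit_ivl unit_ivl"

text \<open>The orbit of a point under a bijection is two-sided.\<close>

definition minimal_iem :: "(real \<Rightarrow> real) \<Rightarrow> bool" where
  "minimal_iem T \<longleftrightarrow>
     (\<forall>t\<in>unit_ivl. unit_ivl \<subseteq> closure {s\<in>unit_ivl. \<exists>n. (T ^^ n) t = s \<or> (T ^^ n) s = t})"

definition return_time :: "(real \<Rightarrow> real) \<Rightarrow> real \<Rightarrow> real \<Rightarrow> nat" where
  "return_time T \<alpha> t = (LEAST n. n \<ge> 1 \<and> (T ^^ n) t \<in> {0..<\<alpha>})"

definition self_similar :: "(real \<Rightarrow> real) \<Rightarrow> real \<Rightarrow> bool" where
  "self_similar T \<alpha> \<longleftrightarrow> 0 < \<alpha> \<and> \<alpha> < 1 \<and>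
     (\<forall>t\<in>{0..<\<alpha>}. (\<exists>n\<ge>1. (T ^^ n) t \<in> {0..<\<alpha>}) \<and>
        (T ^^ return_time T \<alpha> t) t = \<alpha> * T (t / \<alpha>))"

definition associated_substitution ::
  "(real \<Rightarrow> real) \<Rightarrow> ('a \<Rightarrow> real set) \<Rightarrow> real \<Rightarrow> ('a \<Rightarrow> 'a list) \<Rightarrow> bool" where
  "associated_substitution T Iv \<alpha> \<sigma> \<longleftrightarrow>
     (\<forall>a. \<sigma> a \<noteq> [] \<and>
        (\<forall>t \<in> (*) \<alpha> ` Iv a. return_time T \<alpha> t = length (\<sigma> a)) \<and>
        (\<forall>m < length (\<sigma> a). (T ^^ m) ` ((*) \<alpha> ` Iv a) \<subseteq> Iv (\<sigma> a ! m)))"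

definition primitive_subst :: "('a \<Rightarrow> 'a list) \<Rightarrow> bool" where
  "primitive_subst \<sigma> \<longleftrightarrow>
     (\<exists>k\<ge>1. \<forall>a b. b \<in> set (((\<lambda>w. concat (map \<sigma> w)) ^^ k) [a]))"

definition subst_matrix :: "('a::finite \<Rightarrow> 'a list) \<Rightarrow> complex ^ 'a ^ 'a" where
  "subst_matrix \<sigma> = (\<chi> a b. of_nat (count_list (\<sigma> a) b))"

definition is_eigenvector :: "complex ^ 'a ^ 'a \<Rightarrow> complex \<Rightarrow> complex ^ 'a \<Rightarrow> bool" where
  "is_eigenvector M \<beta> \<Gamma> \<longleftrightarrow> \<Gamma> \<noteq> 0 \<and> M *v \<Gamma> = \<beta> *s \<Gamma>"

definition direction :: "complex \<Rightarrow> complex" where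
  "direction \<beta> = \<beta> / of_real (cmod \<beta>)"


section \<open>Fractals\<close>

type_synonym 'a label = "'a list \<times> 'a \<times> 'a list"

definition word_val :: "complex ^ 'a \<Rightarrow> 'a list \<Rightarrow> complex" where
  "word_val \<Gamma> w = (\<Sum>a\<leftarrow>w. \<Gamma> $ a)"

definition labels_of :: "('a \<Rightarrow> 'a list) \<Rightarrow> 'a \<Rightarrow> 'a label set" where
  "labels_of \<sigma> a = {(p, c, s). \<sigma> a = p @ [c] @ s}"

definition labels :: "('a \<Rightarrow> 'a list) \<Rightarrow> 'a label set" where
  "labels \<sigma> = (\<Union>a. labels_of \<sigma> a)"

text \<open>A sequence \<open>(x\<^sub>m)\<close> with \<open>m \<ge> 1\<close> is indexed from 0: \<open>x m\<close> is its entry number \<open>m + 1\<close>.\<close>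

definition seqs :: "('a \<Rightarrow> 'a list) \<Rightarrow> 'a \<Rightarrow> (nat \<Rightarrow> 'a label) set" where
  "seqs \<sigma> a = {x. x 0 \<in> labels_of \<sigma> a \<and> (\<forall>m. x (Suc m) \<in> labels_of \<sigma> (fst (snd (x m))))}"

definition seq_val :: "complex \<Rightarrow> complex ^ 'a \<Rightarrow> (nat \<Rightarrow> 'a label) \<Rightarrow> complex" where
  "seq_val \<beta> \<Gamma> x = (\<Sum>m. word_val \<Gamma> (fst (x m)) / \<beta> ^ Suc m)"

definition fractal :: "('a \<Rightarrow> 'a list) \<Rightarrow> complex \<Rightarrow> complex ^ 'a \<Rightarrow> 'a \<Rightarrow> complex set" where
  "fractal \<sigma> \<beta> \<Gamma> a = seq_val \<beta> \<Gamma> ` seqs \<sigma> a"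

definition subfractal ::
  "('a \<Rightarrow> 'a list) \<Rightarrow> complex \<Rightarrow> complex ^ 'a \<Rightarrow> 'a \<Rightarrow> 'a label \<Rightarrow> complex set" where
  "subfractal \<sigma> \<beta> \<Gamma> a l = seq_val \<beta> \<Gamma> ` {x \<in> seqs \<sigma> a. x 0 = l}"

text \<open>The infimum is a minimum when \<open>F\<close> is compact and nonempty.\<close>

definition support_min :: "complex set \<Rightarrow> complex \<Rightarrow> real" where
  "support_min F \<tau> = (INF z\<in>F. Re (\<tau> * z))"

definition extreme_for :: "complex set \<Rightarrow> complex \<Rightarrow> complex \<Rightarrow> bool" where
  "extreme_for F \<tau> z \<longleftrightarrow> z \<in> F \<and> Re (\<tau> * z) = support_min F \<tau>"

definition unique_representation ::
  "('a \<Rightarrow> 'a list) \<Rightarrow> complex \<Rightarrow> complex ^ 'a \<Rightarrow> bool" where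
  "unique_representation \<sigma> \<beta> \<Gamma> \<longleftrightarrow>
     (\<forall>a z. (\<exists>\<tau>\<in>sphere 0 1. extreme_for (fractal \<sigma> \<beta> \<Gamma> a) \<tau> z) \<longrightarrow>
        (\<exists>!x. x \<in> seqs \<sigma> a \<and> seq_val \<beta> \<Gamma> x = z))"


section \<open>The map H\<close>

definition X_space :: "('a \<Rightarrow> 'a list) \<Rightarrow> (complex \<times> 'a label) set" where
  "X_space \<sigma> = sphere 0 1 \<times> labels \<sigma>"

text \<open>
  The last conjunct is right-continuity along the positively oriented circle for the discrete
  topology on labels; the first coordinate of the map is continuous anyway. Under the unique
  representation property exactly one map satisfies the predicate (extensionality fixes its
  values off \<open>X_space \<sigma>\<close>), which is what the definite description below relies on.
\<close>

definition is_H_map ::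
  "('a \<Rightarrow> 'a list) \<Rightarrow> complex \<Rightarrow> complex ^ 'a \<Rightarrow>
     (complex \<times> 'a label \<Rightarrow> complex \<times> 'a label) \<Rightarrow> bool" where
  "is_H_map \<sigma> \<beta> \<Gamma> H \<longleftrightarrow>
     H \<in> extensional (X_space \<sigma>) \<and>
     (\<forall>\<tau> q a r. (\<tau>, (q, a, r)) \<in> X_space \<sigma> \<longrightarrow>
        (\<exists>l\<in>labels_of \<sigma> a.
           support_min (fractal \<sigma> \<beta> \<Gamma> a) \<tau> = support_min (subfractal \<sigma> \<beta> \<Gamma> a l) \<tau> \<and>
           H (\<tau>, (q, a, r)) = (inverse (direction \<beta>) * \<tau>, l))) \<and>
     (\<forall>\<tau> k. (\<tau>, k) \<in> X_space \<sigma> \<longrightarrow>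
        (\<forall>\<^sub>F \<theta> in at_right 0. snd (H (\<tau> * cis \<theta>, k)) = snd (H (\<tau>, k))))"

definition H_map ::
  "('a \<Rightarrow> 'a list) \<Rightarrow> complex \<Rightarrow> complex ^ 'a \<Rightarrow> complex \<times> 'a label \<Rightarrow> complex \<times> 'a label" where
  "H_map \<sigma> \<beta> \<Gamma> = (THE H. is_H_map \<sigma> \<beta> \<Gamma> H)"

text \<open>
  \<open>pos\<close> numbers the labels by \<open>0, \<dots>, card (labels \<sigma>) - 1\<close>, i.e. it is the chosen left-to-right
  order of the intervals representing the circles.
\<close>

definition circle_to_ivl ::
  "('a \<Rightarrow> 'a list) \<Rightarrow> ('a label \<Rightarrow> nat) \<Rightarrow> complex \<times> 'a label \<Rightarrow> real" where
  "circle_to_ivl \<sigma> pos = (\<lambda>(\<tau>, l). (real (pos l) + Arg2pi \<tau> / (2 * pi)) / real (card (labels \<sigma>)))"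

definition H_ivl ::
  "('a \<Rightarrow> 'a list) \<Rightarrow> complex \<Rightarrow> complex ^ 'a \<Rightarrow> ('a label \<Rightarrow> nat) \<Rightarrow> real \<Rightarrow> real" where
  "H_ivl \<sigma> \<beta> \<Gamma> pos t =
     circle_to_ivl \<sigma> pos (H_map \<sigma> \<beta> \<Gamma> (inv_into (X_space \<sigma>) (circle_to_ivl \<sigma> pos) t))"


section \<open>Minimal components\<close>

text \<open>In this section \<open>h\<close> is a right-continuous, piecewise translation self-map of [0,1).\<close>

definition left_version :: "(real \<Rightarrow> real) \<Rightarrow> real \<Rightarrow> real" where
  "left_version h t = Lim (at_left t) h"

definition discont :: "(real \<Rightarrow> real) \<Rightarrow> real set" where
  "discont h = {t \<in> unit_ivl. \<not> continuous (at t within unit_ivl) h}"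

text \<open>
  \<open>split_set h\<close> consists of the discontinuities of \<open>h\<close> and all their images and (iterated)
  preimages under the left-continuous version, which maps \<open>(0,1]\<close> to itself. Preimages of images
  have to be included (full orbits), since otherwise the extension of a non-injective \<open>h\<close> below
  need not be continuous. The number 1 is left out because the point 1 already plays the role
  of \<open>1\<^sup>-\<close>.
\<close>

definition split_set :: "(real \<Rightarrow> real) \<Rightarrow> real set" where
  "split_set h =
     {t \<in> {0<..<1}. \<exists>d\<in>discont h. \<exists>m n. (left_version h ^^ m) t = (left_version h ^^ n) d}"

text \<open>\<open>Pt t\<close> is the ordinary point \<open>t\<close>, and \<open>Pre t\<close> is \<open>t\<^sup>-\<close>.\<close>

datatype hat_point = Pt real | Pre real

fun hat_less :: "hat_point \<Rightarrow> hat_point \<Rightarrow> bool" where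
  "hat_less (Pt s) (Pt t) \<longleftrightarrow> s < t"
| "hat_less (Pre s) (Pre t) \<longleftrightarrow> s < t"
| "hat_less (Pre s) (Pt t) \<longleftrightarrow> s \<le> t"
| "hat_less (Pt s) (Pre t) \<longleftrightarrow> s < t"

definition hat_ivl :: "(real \<Rightarrow> real) \<Rightarrow> hat_point set" where
  "hat_ivl h = Pt ` unit_ivl \<union> Pre ` split_set h \<union> {Pt 1}"

text \<open>
  The order topology is the intrinsic one of the subset \<open>S\<close>: the end points of the rays are taken
  in \<open>S\<close>.
\<close>

definition order_topology_on :: "('b \<Rightarrow> 'b \<Rightarrow> bool) \<Rightarrow> 'b set \<Rightarrow> 'b topology" where
  "order_topology_on lt S = topology_generated_by
     (insert S ((\<lambda>a. {x\<in>S. lt x a}) ` S \<union> (\<lambda>a. {x\<in>S. lt a x}) ` S))"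

definition hat_top :: "(real \<Rightarrow> real) \<Rightarrow> hat_point topology" where
  "hat_top h = order_topology_on hat_less (hat_ivl h)"

fun hat_map :: "(real \<Rightarrow> real) \<Rightarrow> hat_point \<Rightarrow> hat_point" where
  "hat_map h (Pt t) =
     (if t = 1 then (THE y. limitin (hat_top h) (\<lambda>s. Pt (h s)) y (at_left 1)) else Pt (h t))"
| "hat_map h (Pre t) =
     (if left_version h t = 1 then Pt 1 else Pre (left_version h t))"

definition hat_minimal_component :: "(real \<Rightarrow> real) \<Rightarrow> hat_point set \<Rightarrow> bool" where
  "hat_minimal_component h K \<longleftrightarrow>
     K \<noteq> {} \<and> closedin (hat_top h) K \<and> hat_map h ` K = K \<and>
     (\<forall>x\<in>K. K \<subseteq> hat_top h closure_of (range (\<lambda>n. (hat_map h ^^ n) x)))"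

definition minimal_component :: "(real \<Rightarrow> real) \<Rightarrow> real set \<Rightarrow> bool" where
  "minimal_component h J \<longleftrightarrow>
     (\<exists>K. hat_minimal_component h K \<and> J = {t \<in> unit_ivl. Pt t \<in> K})"

definition iem_on :: "real set \<Rightarrow> (real \<Rightarrow> real) \<Rightarrow> bool" where
  "iem_on J h \<longleftrightarrow> bij_betw h J J \<and>
     (\<exists>P. finite P \<and> partition_on J P \<and>
        (\<forall>K\<in>P. (\<exists>l r. l < r \<and> K = {l..<r}) \<and> (\<exists>d. \<forall>t\<in>K. h t = t + d)))"

end

theory Submission
  imports Defs
begin

text \<open>
  The label chosen by \<open>H\<close> depends only on a letter and on the direction \<open>\<tau>\<close>, and the direction itself
  is rotated by a fixed irrational angle. So \<open>H\<close> is a skew product over an irrational rotation of the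
  circle whose fibre is the finite set of labels, with fibre maps depending on \<open>\<tau>\<close>.

  The unique representation property makes these fibre maps locally constant on both sides of every
  direction. When \<open>\<tau>\<close> is turned slightly to one side, the extreme points of a fractal converge to one
  end of its extreme face for \<open>\<tau>\<close>. This end has a single representation, so all other subfractals,
  being compact, stay away from it, and its first label is the only possible choice on that side
  (\<open>one_sided_minimiser\<close>). In particular \<open>H\<close> is determined by right-continuity (\<open>H_map_eq\<close>).

  The rest is a statement on skew products. Let \<open>J\<close> be a minimal component and \<open>S(\<tau>)\<close> its fibre over
  \<open>\<tau>\<close>. As \<open>J\<close> is mapped onto itself, \<open>|S|\<close> does not increase along the rotation; as \<open>J\<close> is closed in the
  split interval, \<open>S\<close> can only shrink when \<open>\<tau>\<close> moves slightly to the right. Therefore \<open>S\<close> is constant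
  on an interval to the right of a direction where \<open>|S|\<close> is minimal. Every direction is reached from
  that interval by the rotation, so \<open>|S|\<close> is constant on the whole circle (\<open>card_constant\<close>). It follows
  that the fibre maps restrict to bijections between the sets \<open>S(\<tau>)\<close> and that \<open>S\<close> is locally constant
  on both sides of every direction (\<open>S_one_sided_limit\<close>). Hence \<open>H\<close> is bijective on \<open>J\<close>, and by
  compactness \<open>J\<close> splits into finitely many intervals on which \<open>H\<close> is a translation
  (\<open>translated_pieces_from_local\<close>).

  Two minimal components with a common point coincide, because each is the closure of the orbit of
  that point. So they have disjoint fibres over any one direction, which leaves room for finitely
  many only.

  The one delicate point of the split interval is its right end point 1, which stands for its own left
  copy although it is written as an ordinary point. It has to be shown that it does not contribute an
  ordinary image, for otherwise \<open>H\<close> might fail to be onto on \<open>J\<close> (\<open>ordinary_part_invariant\<close>).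
\<close>

section \<open>Skew products over an irrational rotation\<close>

text \<open>
  The circle is \<open>\<real>/\<int>\<close>, and one step of the skew product sends \<open>(u, k)\<close> to \<open>(u - \<rho>, g u k)\<close>.
  One-sided neighbourhoods are written \<open>u + s * x\<close> with \<open>x\<close> tending to 0 from above, so that
  \<open>s = 1\<close> and \<open>s = -1\<close> give the two sides and both can be treated at once.
\<close>

locale irrational_skew_product =
  fixes \<Lambda> :: "'l set" and g :: "real \<Rightarrow> 'l \<Rightarrow> 'l" and \<rho> :: real
  assumes finite_fibre: "finite \<Lambda>"
    and irrational: "\<rho> \<notin> \<rat>"
    and fibre_map: "k \<in> \<Lambda> \<Longrightarrow> g u k \<in> \<Lambda>"
    and one_sided_limit: "s \<in> {1, -1} \<Longrightarrow>
      \<exists>a. \<forall>\<^sub>F x in at_right 0. \<forall>k\<in>\<Lambda>. g (u + s * x) k = a k"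
begin

fun fibre_iterate :: "nat \<Rightarrow> real \<Rightarrow> 'l \<Rightarrow> 'l" where
  "fibre_iterate 0 u k = k"
| "fibre_iterate (Suc j) u k = g (u - real j * \<rho>) (fibre_iterate j u k)"

lemma fibre_iterate_in: "k \<in> \<Lambda> \<Longrightarrow> fibre_iterate j u k \<in> \<Lambda>"
  by (induction j) (auto simp: fibre_map)

lemma fibre_iterate_one_sided_limit:
  assumes s: "s \<in> {1, -1}"
  shows "\<exists>a. \<forall>\<^sub>F x in at_right 0. \<forall>k\<in>\<Lambda>. fibre_iterate j (u + s * x) k = a k"
proof (induction j)
  case 0
  show ?case by (rule exI[of _ id]) simp
next
  case (Suc j)
  then obtain a where a: "\<forall>\<^sub>F x in at_right 0. \<forall>k\<in>\<Lambda>. fibre_iterate j (u + s * x) k = a k" ..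
  obtain b where b: "\<forall>\<^sub>F x in at_right 0. \<forall>k\<in>\<Lambda>. g (u - real j * \<rho> + s * x) k = b k"
    using one_sided_limit[OF s] ..
  have "\<forall>\<^sub>F x in at_right 0. \<forall>k\<in>\<Lambda>. fibre_iterate (Suc j) (u + s * x) k = b (a k)"
    using a b
  proof eventually_elim
    case (elim x)
    show ?case
    proof
      fix k assume k: "k \<in> \<Lambda>"
      have eq: "u + s * x - real j * \<rho> = u - real j * \<rho> + s * x" by simp
      have "a k \<in> \<Lambda>" using elim(1) k fibre_iterate_in[OF k, of j "u + s * x"] by simp
      then show "fibre_iterate (Suc j) (u + s * x) k = b (a k)"
        using elim k by (simp add: eq)
    qed
  qed
  then show ?case by (rule exI[of _ "\<lambda>k. b (a k)"])
qed

end

text \<open>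
  An invariant set is given by its fibres \<open>S u\<close>. Invariance means here only that the fibre maps
  are onto; that they are also injective on \<open>S\<close> will follow from a cardinality argument. Closedness
  in the split interval is expressed by limits from the right.
\<close>

locale invariant_fibres = irrational_skew_product +
  fixes S :: "real \<Rightarrow> 'a set"
  assumes fibre_subset: "S u \<subseteq> \<Lambda>"
    and periodic: "S (u + of_int m) = S u"
    and step: "S (u - \<rho>) = g u ` S u"
    and right_closed: "k \<notin> S u \<Longrightarrow> \<forall>\<^sub>F x in at_right 0. k \<notin> S (u + x)"
begin

lemma finite_S: "finite (S u)"
  using finite_subset[OF fibre_subset finite_fibre] .

lemma S_iterate: "S (u - real j * \<rho>) = fibre_iterate j u ` S u"
proof (induction j)
  case (Suc j)
  have "S (u - real (Suc j) * \<rho>) = S (u - real j * \<rho> - \<rho>)" by (simp add: algebra_simps)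
  also have "\<dots> = g (u - real j * \<rho>) ` S (u - real j * \<rho>)" by (rule step)
  finally show ?case by (simp add: Suc image_image)
qed simp

lemma S_right_subset: "\<forall>\<^sub>F x in at_right 0. S (u + x) \<subseteq> S u"
proof -
  have "\<forall>\<^sub>F x in at_right 0. \<forall>k\<in>\<Lambda> - S u. k \<notin> S (u + x)"
    using finite_fibre right_closed by (intro eventually_ball_finite) auto
  then show ?thesis
    by eventually_elim (use fibre_subset in blast)
qed

text \<open>
  The fibres can only shrink when moving a little to the right, so a fibre of least cardinality is
  repeated on a whole interval. Every backward orbit of the rotation enters that interval, and the
  fibres along a forward orbit are images of one another.
\<close>

lemma template_interval:
  obtains u0 e where "e > 0" "\<And>v. u0 < v \<Longrightarrow> v < u0 + e \<Longrightarrow> S v = S u0" "\<And>u. card (S u0) \<le> card (S u)"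
proof -
  obtain u0 where u0: "\<And>u. card (S u0) \<le> card (S u)"
    using ex_has_least_nat[of "\<lambda>_. True" 0 "\<lambda>u. card (S u)"] by auto
  obtain e where e: "e > 0" "\<And>x. 0 < x \<Longrightarrow> x < e \<Longrightarrow> S (u0 + x) \<subseteq> S u0"
    using S_right_subset[of u0] unfolding eventually_at_right_field by blast
  show thesis
  proof (rule that[of e u0])
    fix v assume v: "u0 < v" "v < u0 + e"
    then have "S v \<subseteq> S u0" using e(2)[of "v - u0"] by simp
    then show "S v = S u0" using u0 finite_S by (meson card_seteq)
  qed (use e u0 in auto)
qed

lemma backward_orbit_enters:
  assumes "e > 0"
  obtains j m where "u0 < u + real j * \<rho> + of_int m" "u + real j * \<rho> + of_int m < u0 + e"
proof -
  have "e/2 > 0" using assms by simp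
  then obtain h k where k: "k > 0" and hk: "\<bar>of_int k * \<rho> - of_int h - (u0 + e/2 - u)\<bar> < e/2"
    by (rule sequence_of_fractional_parts_is_dense[OF irrational])
  have "u + real (nat k) * \<rho> + of_int (- h) - (u0 + e/2) = of_int k * \<rho> - of_int h - (u0 + e/2 - u)"
    using k by (simp add: of_nat_nat)
  with hk have "\<bar>u + real (nat k) * \<rho> + of_int (- h) - (u0 + e/2)\<bar> < e/2" by (simp only:)
  then show thesis unfolding abs_less_iff by (intro that[of "nat k" "- h"]) linarith+
qed

lemma card_constant: "card (S u) = card (S v)"
proof -
  obtain u0 e where e: "e > 0" "\<And>v. u0 < v \<Longrightarrow> v < u0 + e \<Longrightarrow> S v = S u0"
    and least: "\<And>u. card (S u0) \<le> card (S u)" by (rule template_interval) blast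
  have eq: "card (S u) = card (S u0)" for u
  proof -
    obtain j m where jm: "u0 < u + real j * \<rho> + of_int m" "u + real j * \<rho> + of_int m < u0 + e"
      using backward_orbit_enters[OF e(1)] .
    define w where "w = u + real j * \<rho> + of_int m"
    have "S u = S (w - real j * \<rho>)" using periodic[of u m] by (simp add: w_def)
    also have "\<dots> = fibre_iterate j w ` S u0"
      unfolding S_iterate using e(2)[of w] jm by (simp add: w_def)
    finally have "card (S u) \<le> card (S u0)" by (simp add: card_image_le finite_S)
    then show ?thesis using least by (rule le_antisym)
  qed
  show ?thesis by (rule trans[OF eq eq[symmetric]])
qed

lemma fibre_map_inj_on: "inj_on (g u) (S u)"
  using step[of u] card_constant[of "u - \<rho>" u] finite_S by (intro eq_card_imp_inj_on) auto

text \<open>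
  Some image of \<open>u\<close> under the inverse rotation lies in the interior of the interval on which the
  fibres are constant. Coming back by the corresponding iterate, \<open>S\<close> near \<open>u\<close> is the image of
  one fixed set under fibre maps that do not change near \<open>u\<close> on the chosen side.
\<close>

lemma S_one_sided_limit:
  assumes s: "s \<in> {1, -1}"
  shows "\<exists>A. \<forall>\<^sub>F x in at_right 0. S (u + s * x) = A"
proof -
  obtain u0 e where e: "e > 0" "\<And>v. u0 < v \<Longrightarrow> v < u0 + e \<Longrightarrow> S v = S u0"
    by (rule template_interval) blast
  obtain j m where jm: "u0 < u + real j * \<rho> + of_int m" "u + real j * \<rho> + of_int m < u0 + e"
    using backward_orbit_enters[OF e(1)] .
  define w where "w = u + real j * \<rho> + of_int m"
  obtain a where a: "\<forall>\<^sub>F x in at_right 0. \<forall>k\<in>\<Lambda>. fibre_iterate j (w + s * x) k = a k"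
    using fibre_iterate_one_sided_limit[OF s] ..
  have "((\<lambda>x. w + s * x) \<longlongrightarrow> w + s * 0) (at_right 0)" by (intro tendsto_intros)
  then have "\<forall>\<^sub>F x in at_right 0. w + s * x \<in> {u0<..<u0 + e}"
    by (rule topological_tendstoD) (use jm in \<open>auto simp: w_def\<close>)
  with a have "\<forall>\<^sub>F x in at_right 0. S (u + s * x) = a ` S u0"
  proof eventually_elim
    case (elim x)
    have "S (u + s * x) = S (w + s * x - real j * \<rho>)"
      using periodic[of "u + s * x" m] by (simp add: w_def algebra_simps)
    also have "\<dots> = fibre_iterate j (w + s * x) ` S u0"
      unfolding S_iterate using e(2) elim(2) by simp
    also have "\<dots> = a ` S u0" using elim(1) fibre_subset by (intro image_cong) auto
    finally show ?case .
  qed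
  then show ?thesis by blast
qed

lemma S_right_constant: "\<forall>\<^sub>F x in at_right 0. S (u + x) = S u"
  using S_right_subset[of u]
  by eventually_elim (use card_constant finite_S in \<open>metis card_subset_eq\<close>)

end

section \<open>Piecewise translations on finite unions of intervals\<close>

definition translated_pieces :: "(real \<Rightarrow> real) \<Rightarrow> real set \<Rightarrow> bool" where
  "translated_pieces h J \<longleftrightarrow>
     (\<exists>P. finite P \<and> partition_on J P \<and>
        (\<forall>K\<in>P. (\<exists>l r. l < r \<and> K = {l..<r}) \<and> (\<exists>d. \<forall>t\<in>K. h t = t + d)))"

lemma translated_pieces_empty: "translated_pieces h {}"
  unfolding translated_pieces_def by (rule exI[of _ "{}"]) (simp add: partition_on_empty)

lemma translated_pieces_interval:
  assumes "\<And>t. a \<le> t \<Longrightarrow> t < b \<Longrightarrow> h t = t + d"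
  shows "translated_pieces h {a..<b}"
proof (cases "a < b")
  case True
  then have "partition_on {a..<b} {{a..<b}}" by (intro partition_on_space) auto
  then show ?thesis
    unfolding translated_pieces_def using True assms
    by (intro exI[of _ "{{a..<b}}"]) (simp, blast)
qed (simp add: translated_pieces_empty)

lemma translated_pieces_Un:
  assumes "translated_pieces h A" "translated_pieces h B" "A \<inter> B = {}"
  shows "translated_pieces h (A \<union> B)"
proof -
  obtain P where P: "finite P" "partition_on A P"
    "\<forall>K\<in>P. (\<exists>l r. l < r \<and> K = {l..<r}) \<and> (\<exists>d. \<forall>t\<in>K. h t = t + d)"
    using assms(1) unfolding translated_pieces_def by blast
  obtain Q where Q: "finite Q" "partition_on B Q"
    "\<forall>K\<in>Q. (\<exists>l r. l < r \<and> K = {l..<r}) \<and> (\<exists>d. \<forall>t\<in>K. h t = t + d)"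
    using assms(2) unfolding translated_pieces_def by blast
  have "partition_on (A \<union> B) (P \<union> Q)"
    using P(2) Q(2) assms(3) by (simp add: partition_on_def disjoint_union)
  then show ?thesis
    unfolding translated_pieces_def using P(1,3) Q(1,3)
    by (intro exI[of _ "P \<union> Q"] conjI ballI) (simp, assumption, (erule UnE; simp)+)
qed

text \<open>
  Compactness of \<open>[0,1]\<close>, in the form of Bolzano bisection: partitions of adjacent pieces can be
  joined, so it is enough to partition \<open>J\<close> near each point, separately on its two sides.
\<close>

lemma translated_pieces_from_local:
  assumes J: "J \<subseteq> {0..<1}"
    and right: "\<And>x. 0 \<le> x \<Longrightarrow> x < 1 \<Longrightarrow>
      \<exists>e>0. {x..<x + e} \<inter> J = {} \<or> {x..<x + e} \<subseteq> J \<and> (\<exists>d. \<forall>t\<in>{x..<x + e}. h t = t + d)"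
    and left: "\<And>x. 0 < x \<Longrightarrow> x \<le> 1 \<Longrightarrow>
      \<exists>e>0. {x - e..<x} \<inter> J = {} \<or> {x - e..<x} \<subseteq> J \<and> (\<exists>d. \<forall>t\<in>{x - e..<x}. h t = t + d)"
  shows "translated_pieces h J"
proof -
  have right_piece: "\<exists>e>0. \<forall>b<x + e. translated_pieces h (J \<inter> {x..<b})" if "0 \<le> x" "x \<le> 1" for x
  proof (cases "x < 1")
    case True
    then obtain e where e: "e > 0"
      "{x..<x + e} \<inter> J = {} \<or> {x..<x + e} \<subseteq> J \<and> (\<exists>d. \<forall>t\<in>{x..<x + e}. h t = t + d)"
      using right \<open>0 \<le> x\<close> by blast
    have "translated_pieces h (J \<inter> {x..<b})" if "b < x + e" for b
      using e(2)
    proof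
      assume "{x..<x + e} \<inter> J = {}"
      moreover have "J \<inter> {x..<b} \<subseteq> {x..<x + e} \<inter> J" using that by auto
      ultimately show ?thesis by (simp add: translated_pieces_empty)
    next
      assume "{x..<x + e} \<subseteq> J \<and> (\<exists>d. \<forall>t\<in>{x..<x + e}. h t = t + d)"
      then obtain d where "{x..<x + e} \<subseteq> J" "\<forall>t\<in>{x..<x + e}. h t = t + d" by blast
      moreover from this(1) have "J \<inter> {x..<b} = {x..<b}" using that by force
      ultimately show ?thesis
        using that by (auto intro!: translated_pieces_interval[of _ _ _ d])
    qed
    then show ?thesis using e(1) by blast
  next
    case False
    then have "J \<inter> {x..<b} = {}" for b using J by auto
    then show ?thesis by (intro exI[of _ 1]) (simp add: translated_pieces_empty)
  qed
  have left_piece: "\<exists>e>0. \<forall>a>x - e. translated_pieces h (J \<inter> {a..<x})" if "0 \<le> x" "x \<le> 1" for x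
  proof (cases "0 < x")
    case True
    then obtain e where e: "e > 0"
      "{x - e..<x} \<inter> J = {} \<or> {x - e..<x} \<subseteq> J \<and> (\<exists>d. \<forall>t\<in>{x - e..<x}. h t = t + d)"
      using left \<open>x \<le> 1\<close> by blast
    have "translated_pieces h (J \<inter> {a..<x})" if "x - e < a" for a
      using e(2)
    proof
      assume "{x - e..<x} \<inter> J = {}"
      moreover have "J \<inter> {a..<x} \<subseteq> {x - e..<x} \<inter> J" using that by auto
      ultimately show ?thesis by (simp add: translated_pieces_empty)
    next
      assume "{x - e..<x} \<subseteq> J \<and> (\<exists>d. \<forall>t\<in>{x - e..<x}. h t = t + d)"
      then obtain d where "{x - e..<x} \<subseteq> J" "\<forall>t\<in>{x - e..<x}. h t = t + d" by blast
      moreover from this(1) have "J \<inter> {a..<x} = {a..<x}" using that by force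
      ultimately show ?thesis
        using that by (auto intro!: translated_pieces_interval[of _ _ _ d])
    qed
    then show ?thesis using e(1) by blast
  next
    case False
    then have "J \<inter> {a..<x} = {}" for a using J by auto
    then show ?thesis by (intro exI[of _ 1]) (simp add: translated_pieces_empty)
  qed
  have "translated_pieces h (J \<inter> {0..<1})"
  proof (rule Bolzano[of 0 1 "\<lambda>a b. translated_pieces h (J \<inter> {a..<b})"])
    fix a b c :: real
    assume 2: "translated_pieces h (J \<inter> {a..<b})" "translated_pieces h (J \<inter> {b..<c})" "a \<le> b" "b \<le> c"
    then have "J \<inter> {a..<c} = (J \<inter> {a..<b}) \<union> (J \<inter> {b..<c})" by auto
    then show "translated_pieces h (J \<inter> {a..<c})" using 2 by (auto intro!: translated_pieces_Un)
  next
    fix x :: real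
    assume 3: "0 \<le> x" "x \<le> 1"
    obtain e e' where e: "e > 0" "\<forall>b<x + e. translated_pieces h (J \<inter> {x..<b})"
      "e' > 0" "\<forall>a>x - e'. translated_pieces h (J \<inter> {a..<x})"
      using right_piece left_piece 3 by meson
    show "\<exists>d>0. \<forall>a b. a \<le> x \<and> x \<le> b \<and> b - a < d \<longrightarrow> translated_pieces h (J \<inter> {a..<b})"
    proof (intro exI[of _ "min e e'"] conjI allI impI)
      fix a b assume ab: "a \<le> x \<and> x \<le> b \<and> b - a < min e e'"
      then have "J \<inter> {a..<b} = (J \<inter> {a..<x}) \<union> (J \<inter> {x..<b})" by auto
      moreover have "translated_pieces h (J \<inter> {a..<x})" "translated_pieces h (J \<inter> {x..<b})"
        using e ab by auto
      ultimately show "translated_pieces h (J \<inter> {a..<b})"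
        by (auto intro!: translated_pieces_Un)
    qed (use e in auto)
  qed simp
  moreover have "J \<inter> {0..<1} = J" using J by blast
  ultimately show ?thesis by simp
qed

section \<open>The split interval\<close>

lemma topspace_hat_top: "topspace (hat_top h) = hat_ivl h"
  unfolding hat_top_def order_topology_on_def topology_generated_by_topspace by auto

lemma openin_hat_ray:
  assumes "a \<in> hat_ivl h"
  shows "openin (hat_top h) {x \<in> hat_ivl h. hat_less x a}"
    and "openin (hat_top h) {x \<in> hat_ivl h. hat_less a x}"
  unfolding hat_top_def order_topology_on_def using assms
  by (auto intro!: topology_generated_by_Basis)

lemma hat_less_trans: "hat_less p q \<Longrightarrow> hat_less q r \<Longrightarrow> hat_less p r"
  by (cases p; cases q; cases r) auto

lemma hat_less_irrefl: "\<not> hat_less p p"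
  by (cases p) auto

lemma hat_less_linear: "p \<noteq> q \<Longrightarrow> hat_less p q \<or> hat_less q p"
  by (cases p; cases q) auto

text \<open>
  Two points are separated by the rays at a point between them, or, if there is none, by the rays
  at the two points themselves.
\<close>

lemma Hausdorff_hat_top: "Hausdorff_space (hat_top h)"
proof -
  have separated: "\<exists>U V. openin (hat_top h) U \<and> openin (hat_top h) V \<and> p \<in> U \<and> q \<in> V \<and> disjnt U V"
    if pq: "p \<in> hat_ivl h" "q \<in> hat_ivl h" "hat_less p q" for p q
  proof (cases "\<exists>m\<in>hat_ivl h. hat_less p m \<and> hat_less m q")
    case True
    then obtain m where m: "m \<in> hat_ivl h" "hat_less p m" "hat_less m q" by blast
    then show ?thesis
      using pq openin_hat_ray[OF m(1)] hat_less_trans hat_less_irrefl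
      by (intro exI[of _ "{x \<in> hat_ivl h. hat_less x m}"] exI[of _ "{x \<in> hat_ivl h. hat_less m x}"])
        (auto simp: disjnt_iff)
  next
    case False
    then show ?thesis
      using pq openin_hat_ray[OF pq(1)] openin_hat_ray[OF pq(2)]
      by (intro exI[of _ "{x \<in> hat_ivl h. hat_less x q}"] exI[of _ "{x \<in> hat_ivl h. hat_less p x}"])
        (auto simp: disjnt_iff)
  qed
  show ?thesis
    unfolding Hausdorff_space_def topspace_hat_top
    using separated hat_less_linear by (metis disjnt_sym)
qed

text \<open>
  The rays generate the topology, so convergence can be tested on them.
\<close>

lemma limitin_hat_topI:
  assumes "p \<in> hat_ivl h"
    and "\<forall>\<^sub>F s in F. f s \<in> hat_ivl h"
    and below: "\<And>a. a \<in> hat_ivl h \<Longrightarrow> hat_less p a \<Longrightarrow> \<forall>\<^sub>F s in F. hat_less (f s) a"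
    and above: "\<And>a. a \<in> hat_ivl h \<Longrightarrow> hat_less a p \<Longrightarrow> \<forall>\<^sub>F s in F. hat_less a (f s)"
  shows "limitin (hat_top h) f p F"
  unfolding limitin_def
proof (intro conjI allI impI)
  fix V assume V: "openin (hat_top h) V \<and> p \<in> V"
  then have "generate_topology_on (insert (hat_ivl h)
      ((\<lambda>a. {x\<in>hat_ivl h. hat_less x a}) ` hat_ivl h \<union> (\<lambda>a. {x\<in>hat_ivl h. hat_less a x}) ` hat_ivl h)) V"
    unfolding hat_top_def order_topology_on_def by (simp add: openin_topology_generated_by_iff)
  moreover have "p \<in> V" using V by blast
  ultimately show "\<forall>\<^sub>F s in F. f s \<in> V"
  proof (induction V rule: generate_topology_on.induct)
    case (Int a b)
    then show ?case by (auto simp: eventually_conj_iff)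
  next
    case (UN K)
    then obtain k where "k \<in> K" "\<forall>\<^sub>F s in F. f s \<in> k" by blast
    then show ?case by (auto elim: eventually_mono)
  next
    case (Basis V)
    then consider "V = hat_ivl h" | a where "a \<in> hat_ivl h" "V = {x\<in>hat_ivl h. hat_less x a}"
      | a where "a \<in> hat_ivl h" "V = {x\<in>hat_ivl h. hat_less a x}" by blast
    then show ?case
      by cases (use Basis.prems assms(2) below above in \<open>auto simp: eventually_conj_iff\<close>)
  qed simp
qed (use assms topspace_hat_top in auto)

lemma limitin_hat_right:
  assumes "0 \<le> t" "t < 1"
  shows "limitin (hat_top h) Pt (Pt t) (at_right t)"
proof (rule limitin_hat_topI)
  have "\<forall>\<^sub>F s in at_right t. s \<in> {t<..<1}" using assms by (intro eventually_at_right_real)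
  then show "\<forall>\<^sub>F s in at_right t. Pt s \<in> hat_ivl h"
    by eventually_elim (use assms in \<open>auto simp: hat_ivl_def\<close>)
next
  fix a assume a: "hat_less (Pt t) a"
  then obtain b where b: "a = Pt b \<or> a = Pre b" "t < b" by (cases a) auto
  have "\<forall>\<^sub>F s in at_right t. s \<in> {t<..<b}" using b by (intro eventually_at_right_real) auto
  then show "\<forall>\<^sub>F s in at_right t. hat_less (Pt s) a"
    by eventually_elim (use b in auto)
next
  fix a assume a: "hat_less a (Pt t)"
  have "\<forall>\<^sub>F s in at_right t. t < s" by (simp add: eventually_at_right_less)
  then show "\<forall>\<^sub>F s in at_right t. hat_less a (Pt s)"
    by eventually_elim (use a in \<open>cases a; auto\<close>)
qed (use assms in \<open>auto simp: hat_ivl_def\<close>)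

lemma closedin_hat_right:
  assumes "closedin (hat_top h) K" "0 \<le> t" "t < 1" "Pt t \<notin> K"
  shows "\<forall>\<^sub>F s in at_right t. Pt s \<notin> K"
proof -
  have "openin (hat_top h) (hat_ivl h - K)"
    using assms(1) by (metis closedin_def topspace_hat_top)
  moreover have "Pt t \<in> hat_ivl h - K" using assms by (auto simp: hat_ivl_def)
  ultimately have "\<forall>\<^sub>F s in at_right t. Pt s \<in> hat_ivl h - K"
    using limitin_hat_right[OF assms(2,3)] unfolding limitin_def by blast
  then show ?thesis by eventually_elim simp
qed

text \<open>
  The point to be approached at 1 is the left copy of the left limit of \<open>h\<close>; it belongs to the
  split interval only if that limit is 1 or one of the split points.
\<close>

lemma hat_map_one:
  assumes translation: "\<forall>\<^sub>F s in at_left 1. h s = s + d"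
    and limit: "0 < 1 + d" "1 + d \<le> 1" "1 + d < 1 \<Longrightarrow> 1 + d \<in> split_set h"
  shows "hat_map h (Pt 1) = (if 1 + d = 1 then Pt 1 else Pre (1 + d))" (is "_ = ?p")
proof -
  have "limitin (hat_top h) (\<lambda>s. Pt (h s)) ?p (at_left 1)"
  proof (rule limitin_hat_topI)
    show "?p \<in> hat_ivl h" using limit by (auto simp: hat_ivl_def)
  next
    have "\<forall>\<^sub>F s in at_left 1. s \<in> {-d<..<1}" using limit by (intro eventually_at_left_real) auto
    with translation show "\<forall>\<^sub>F s in at_left 1. Pt (h s) \<in> hat_ivl h"
      by eventually_elim (use limit in \<open>auto simp: hat_ivl_def\<close>)
  next
    fix a assume a: "hat_less ?p a"
    have "\<forall>\<^sub>F s in at_left 1. s < (1::real)" by (simp add: eventually_at_filter)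
    with translation show "\<forall>\<^sub>F s in at_left 1. hat_less (Pt (h s)) a"
      by eventually_elim (use a in \<open>cases a; auto split: if_splits\<close>)
  next
    fix a assume "a \<in> hat_ivl h" and a: "hat_less a ?p"
    then obtain b where b: "a = Pt b \<or> a = Pre b" "b < 1 + d"
      by (cases a) (auto simp: hat_ivl_def split_set_def split: if_splits)
    have "\<forall>\<^sub>F s in at_left 1. s \<in> {b - d<..<1}" using b by (intro eventually_at_left_real) auto
    with translation show "\<forall>\<^sub>F s in at_left 1. hat_less a (Pt (h s))"
      by eventually_elim (use b in auto)
  qed
  note lim = this
  have "(THE y. limitin (hat_top h) (\<lambda>s. Pt (h s)) y (at_left 1)) = ?p"
  proof (rule the_equality)
    show "q = ?p" if "limitin (hat_top h) (\<lambda>s. Pt (h s)) q (at_left 1)" for q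
      by (rule limitin_Hausdorff_unique[OF that lim trivial_limit_at_left_real Hausdorff_hat_top])
  qed (rule lim)
  then show ?thesis by simp
qed

text \<open>
  Ordinary points have ordinary images. Conversely, left copies never produce an ordinary point of
  \<open>[0,1)\<close>, and neither does the end point 1 when it lies in an invariant set: it is then either
  fixed or the image of the left copy of a discontinuity, which puts its own image among the split
  points.
\<close>

lemma ordinary_part_invariant:
  assumes self_map: "\<And>t. 0 \<le> t \<Longrightarrow> t < 1 \<Longrightarrow> 0 \<le> h t \<and> h t < 1"
    and translation: "\<forall>\<^sub>F s in at_left 1. h s = s + d"
    and K: "K \<subseteq> hat_ivl h" "hat_map h ` K = K"
  shows "h ` {t \<in> unit_ivl. Pt t \<in> K} = {t \<in> unit_ivl. Pt t \<in> K}" (is "h ` ?J = ?J")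
proof (rule antisym)
  show "h ` ?J \<subseteq> ?J"
  proof
    fix y assume "y \<in> h ` ?J"
    then obtain t where t: "0 \<le> t" "t < 1" "Pt t \<in> K" "y = h t" by auto
    then have "hat_map h (Pt t) \<in> K" using K(2) by blast
    with t show "y \<in> ?J" using self_map by simp
  qed
next
  \<comment> \<open>Since \<open>h\<close> takes values in \<open>[0,1)\<close>, its left limit at 1 lies in \<open>(0,1]\<close>.\<close>
  have left_limit: "left_version h 1 = 1 + d"
    unfolding left_version_def
  proof (rule tendsto_Lim)
    have "((\<lambda>s. s + d) \<longlongrightarrow> 1 + d) (at_left 1)" by (intro tendsto_intros)
    then show "(h \<longlongrightarrow> 1 + d) (at_left 1)"
      using translation by (simp add: filterlim_cong)
  qed simp
  obtain e where e: "e < 1" "\<And>s. e < s \<Longrightarrow> s < 1 \<Longrightarrow> h s = s + d"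
    using translation unfolding eventually_at_left_field by metis
  have d0: "0 < 1 + d"
  proof -
    define s where "s = (max e 0 + 1) / 2"
    have "0 \<le> s" "e < s" "s < 1" using e(1) by (auto simp: s_def)
    then show ?thesis using e(2)[of s] self_map[of s] by auto
  qed
  have d1: "1 + d \<le> 1"
  proof (rule ccontr)
    assume "\<not> 1 + d \<le> 1"
    then obtain s where "max (max e 0) (1 - d) < s" "s < 1"
      using dense[of "max (max e 0) (1 - d)" 1] e(1) by auto
    then show False using e(2)[of s] self_map[of s] by auto
  qed
  have one: "hat_map h (Pt 1) \<notin> Pt ` unit_ivl" if "Pt 1 \<in> K"
  proof -
    have "Pt 1 \<in> hat_map h ` K" using that by (subst K(2))
    then obtain y where y: "y \<in> K" "hat_map h y = Pt 1" by (elim imageE) (rule that[OF _ sym])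
    show ?thesis
    proof (cases y)
      case (Pt s)
      have "s = 1"
      proof (rule ccontr)
        assume s: "s \<noteq> 1"
        have "Pt s \<in> hat_ivl h" using subsetD[OF K(1) y(1)] Pt by simp
        with s have "0 \<le> s" "s < 1" by (simp_all add: hat_ivl_def image_iff)
        then show False using y(2) s Pt self_map[of s] by simp
      qed
      then show ?thesis using y(2) Pt by auto
    next
      case (Pre t)
      then have "Pre t \<in> hat_ivl h" using subsetD[OF K(1) y(1)] by simp
      then have "t \<in> split_set h" by (simp add: hat_ivl_def image_iff)
      then have t: "0 < t" "t < 1" by (simp_all add: split_set_def)
      have lt: "left_version h t = 1"
        using y(2) Pre by (metis hat_map.simps(2) hat_point.distinct(1))
      \<comment> \<open>The left limit 1 is not a value of \<open>h\<close>.\<close>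
      have "t \<in> discont h"
      proof (rule ccontr)
        assume "t \<notin> discont h"
        then have "continuous (at t within unit_ivl) h" using t by (simp add: discont_def)
        moreover have "at t within unit_ivl = at t"
          using t by (intro at_within_interior) simp
        ultimately have "(h \<longlongrightarrow> h t) (at t)" by (simp add: continuous_within)
        then have "(h \<longlongrightarrow> h t) (at_left t)" by (rule tendsto_mono[OF at_le, rotated]) simp
        then have "left_version h t = h t" unfolding left_version_def by (intro tendsto_Lim) auto
        then show False using lt self_map[of t] t by simp
      qed
      moreover have "(left_version h ^^ 0) (1 + d) = (left_version h ^^ 2) t"
        using lt left_limit by (simp add: numeral_2_eq_2)
      ultimately have "1 + d \<in> split_set h" if "1 + d < 1"
        using d0 that unfolding split_set_def
        by (intro CollectI conjI bexI[of _ t] exI[of _ 0] exI[of _ 2]) auto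
      then have "hat_map h (Pt 1) = (if 1 + d = 1 then Pt 1 else Pre (1 + d))"
        by (intro hat_map_one[OF translation]) (use d0 d1 in auto)
      then show ?thesis by auto
    qed
  qed
  show "?J \<subseteq> h ` ?J"
  proof
    fix t assume t: "t \<in> ?J"
    have "Pt t \<in> hat_map h ` K" using t by (subst K(2)) simp
    then obtain y where y: "y \<in> K" "hat_map h y = Pt t" by (elim imageE) (rule that[OF _ sym])
    show "t \<in> h ` ?J"
    proof (cases y)
      case (Pt s)
      have s: "s \<noteq> 1" using one y t Pt by auto
      have "Pt s \<in> hat_ivl h" using subsetD[OF K(1) y(1)] Pt by simp
      with s have "0 \<le> s" "s < 1" by (simp_all add: hat_ivl_def image_iff)
      then show ?thesis using y Pt by auto
    next
      case (Pre s)
      then show ?thesis using y(2) t by (auto split: if_splits)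
    qed
  qed
qed

lemma hat_minimal_component_unique:
  assumes "hat_minimal_component h K" "hat_minimal_component h K'" "p \<in> K" "p \<in> K'"
  shows "K = K'"
proof -
  have "A \<subseteq> B" if A: "hat_minimal_component h A" "p \<in> A" and B: "hat_minimal_component h B" "p \<in> B" for A B
  proof -
    have "(hat_map h ^^ n) p \<in> B" for n
      using B by (induction n) (auto simp: hat_minimal_component_def)
    then have "hat_top h closure_of (range (\<lambda>n. (hat_map h ^^ n) p)) \<subseteq> B"
      using B(1) by (intro closure_of_minimal) (auto simp: hat_minimal_component_def)
    then show ?thesis using A unfolding hat_minimal_component_def by blast
  qed
  then show ?thesis using assms by blast
qed

section \<open>Compactness of the fractals\<close>

lemma finite_labels_of: "finite (labels_of \<sigma> a)"
proof -
  have "labels_of \<sigma> a \<subseteq> (\<lambda>i. (take i (\<sigma> a), \<sigma> a ! i, drop (Suc i) (\<sigma> a))) ` {..<length (\<sigma> a)}"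
  proof
    fix l assume "l \<in> labels_of \<sigma> a"
    then obtain p c s where l: "l = (p, c, s)" "\<sigma> a = p @ [c] @ s"
      by (auto simp: labels_of_def)
    then show "l \<in> (\<lambda>i. (take i (\<sigma> a), \<sigma> a ! i, drop (Suc i) (\<sigma> a))) ` {..<length (\<sigma> a)}"
      by (intro image_eqI[of _ _ "length p"]) auto
  qed
  then show ?thesis by (rule finite_subset) simp
qed

lemma finite_labels: "finite (labels (\<sigma> :: 'a::finite \<Rightarrow> 'a list))"
  unfolding labels_def by (simp add: finite_labels_of)

lemma labels_of_subset: "labels_of \<sigma> a \<subseteq> labels \<sigma>"
  unfolding labels_def by blast

lemma labels_of_nonempty:
  assumes "\<sigma> a \<noteq> []"
  shows "labels_of \<sigma> a \<noteq> {}"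
proof -
  have "([], hd (\<sigma> a), tl (\<sigma> a)) \<in> labels_of \<sigma> a"
    using assms by (simp add: labels_of_def)
  then show ?thesis by blast
qed

lemma seqs_extend:
  assumes nonempty: "\<And>a. \<sigma> a \<noteq> []" and l: "l \<in> labels_of \<sigma> a"
  obtains x where "x \<in> seqs \<sigma> a" "x 0 = l"
proof -
  define ch where "ch c = (SOME l. l \<in> labels_of \<sigma> c)" for c
  have ch: "ch c \<in> labels_of \<sigma> c" for c
    using labels_of_nonempty[of \<sigma> c] nonempty unfolding ch_def by (simp add: some_in_eq)
  define x where "x = rec_nat l (\<lambda>_ k. ch (fst (snd k)))"
  have "x \<in> seqs \<sigma> a" "x 0 = l"
    using ch l by (simp_all add: seqs_def x_def)
  then show thesis by (rule that)
qed

lemma seqs_in_labels: "x \<in> seqs \<sigma> a \<Longrightarrow> x m \<in> labels \<sigma>"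
  using labels_of_subset[of \<sigma>] by (cases m) (auto simp: seqs_def)

text \<open>
  Label sequences form a compact space by Tychonoff's theorem, the admissible ones are closed in
  it, and the series for \<open>seq_val\<close> converges uniformly because only finitely many labels occur.
\<close>

lemma compact_seq_val_image:
  fixes \<sigma> :: "'a::finite \<Rightarrow> 'a list"
  assumes expanding: "1 < cmod \<beta>"
  shows "compact (seq_val \<beta> \<Gamma> ` {x \<in> seqs \<sigma> a. x 0 \<in> A})"
proof -
  define X where "X = product_topology (\<lambda>_::nat. discrete_topology (labels \<sigma>)) UNIV"
  have topspace_X: "topspace X = {x. \<forall>m. x m \<in> labels \<sigma>}"
    by (auto simp: X_def PiE_def Pi_def)
  have compact_X: "compact_space X"
    unfolding X_def by (simp add: compact_space_product_topology compact_space_discrete_topology finite_labels)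
  have coordinate: "continuous_map X Y (\<lambda>x. f (x m))"
    if "\<And>k. k \<in> labels \<sigma> \<Longrightarrow> f k \<in> topspace Y" for f m and Y :: "'b topology"
  proof -
    have "continuous_map X (discrete_topology (labels \<sigma>)) (\<lambda>x. x m)"
      unfolding X_def using continuous_map_product_projection[of m UNIV "\<lambda>_. discrete_topology (labels \<sigma>)"] by simp
    moreover have "continuous_map (discrete_topology (labels \<sigma>)) Y f"
      using that by (simp add: continuous_map_from_discrete_topology Pi_iff)
    ultimately show ?thesis by (rule continuous_map_compose[unfolded o_def])
  qed
  have cylinder: "closedin X {x \<in> topspace X. x m \<in> B}" for m B
  proof -
    have "continuous_map X (discrete_topology UNIV) (\<lambda>x. x m)"
      using coordinate[of id "discrete_topology UNIV" m] by simp
    then show ?thesis by (rule closedin_continuous_map_preimage) simp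
  qed
  have admissible: "x \<in> seqs \<sigma> a \<longleftrightarrow> (\<forall>m. x m \<in> labels \<sigma>) \<and> x 0 \<in> labels_of \<sigma> a \<and>
      (\<forall>m. x (Suc m) \<in> labels_of \<sigma> (fst (snd (x m))))" for x
    using seqs_in_labels[of x \<sigma> a] by (auto simp: seqs_def)
  have "{x \<in> seqs \<sigma> a. x 0 \<in> A} =
      {x \<in> topspace X. x 0 \<in> labels_of \<sigma> a \<inter> A} \<inter>
      (\<Inter>m. \<Union>k\<in>labels \<sigma>. {x \<in> topspace X. x m \<in> {k}} \<inter>
        {x \<in> topspace X. x (Suc m) \<in> labels_of \<sigma> (fst (snd k))})" (is "_ = ?C")
    by (auto simp: admissible topspace_X)
  moreover have "closedin X ?C"
  proof (intro closedin_Int closedin_INT closedin_Union finite_imageI finite_labels cylinder)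
    fix m Z
    assume "Z \<in> (\<lambda>k. {x \<in> topspace X. x m \<in> {k}} \<inter>
        {x \<in> topspace X. x (Suc m) \<in> labels_of \<sigma> (fst (snd k))}) ` labels \<sigma>"
    then show "closedin X Z" by (elim imageE) (simp only: closedin_Int cylinder)
  qed simp
  ultimately have "compactin X {x \<in> seqs \<sigma> a. x 0 \<in> A}"
    using compact_X by (simp add: closedin_compact_space)
  moreover have "continuous_map X euclidean (seq_val \<beta> \<Gamma>)"
  proof -
    define B where "B = (\<Sum>k\<in>labels \<sigma>. cmod (word_val \<Gamma> (fst k)))"
    have B: "cmod (word_val \<Gamma> (fst k)) \<le> B" if "k \<in> labels \<sigma>" for k
      unfolding B_def using that finite_labels by (intro member_le_sum) auto
    have "uniform_limit (topspace X)
      (\<lambda>n x. \<Sum>m<n. word_val \<Gamma> (fst (x m)) / \<beta> ^ Suc m)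
      (\<lambda>x. \<Sum>m. word_val \<Gamma> (fst (x m)) / \<beta> ^ Suc m) sequentially"
    proof (rule Weierstrass_m_test)
      fix m and x :: "nat \<Rightarrow> 'a label"
      assume "x \<in> topspace X"
      then have "cmod (word_val \<Gamma> (fst (x m))) \<le> B" using B topspace_X by blast
      then show "cmod (word_val \<Gamma> (fst (x m)) / \<beta> ^ Suc m) \<le> B * (1 / cmod \<beta>) ^ Suc m"
        unfolding norm_divide norm_power power_one_over
        by (simp only: times_divide_eq_right mult_1_right) (rule divide_right_mono, auto)
    next
      have "summable (\<lambda>m. (1 / cmod \<beta>) ^ m)"
        using expanding by (intro summable_geometric) (simp add: divide_less_eq_1)
      then have "summable (\<lambda>m. (1 / cmod \<beta>) ^ Suc m)" by (subst summable_Suc_iff)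
      then show "summable (\<lambda>m. B * (1 / cmod \<beta>) ^ Suc m)" by (rule summable_mult)
    qed
    note unif = this
    have "continuous_map X (Met_TC.mtopology) (\<lambda>x. \<Sum>m. word_val \<Gamma> (fst (x m)) / \<beta> ^ Suc m)"
    proof (rule Met_TC.continuous_map_uniform_limit)
      show "\<forall>\<^sub>F n in sequentially. continuous_map X Met_TC.mtopology
        (\<lambda>x. \<Sum>m<n. word_val \<Gamma> (fst (x m)) / \<beta> ^ Suc m)"
        unfolding mtopology_is_euclidean
      proof (intro always_eventually allI continuous_map_sum)
        show "continuous_map X euclidean (\<lambda>x. word_val \<Gamma> (fst (x m)) / \<beta> ^ Suc m)" for m
          using coordinate[of "\<lambda>k. word_val \<Gamma> (fst k) / \<beta> ^ Suc m" euclidean m] by simp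
      qed simp
      show "\<forall>\<^sub>F n in sequentially. \<forall>x\<in>topspace X.
          (\<Sum>m. word_val \<Gamma> (fst (x m)) / \<beta> ^ Suc m) \<in> UNIV \<and>
          dist (\<Sum>m<n. word_val \<Gamma> (fst (x m)) / \<beta> ^ Suc m)
            (\<Sum>m. word_val \<Gamma> (fst (x m)) / \<beta> ^ Suc m) < e" if "e > 0" for e
        using uniform_limitD[OF unif that] by simp
    qed simp
    then show ?thesis unfolding mtopology_is_euclidean seq_val_def[abs_def] .
  qed
  ultimately have "compactin euclidean (seq_val \<beta> \<Gamma> ` {x \<in> seqs \<sigma> a. x 0 \<in> A})"
    by (rule image_compactin)
  then show ?thesis by simp
qed

section \<open>The one-sided choice of the label\<close>

lemma support_min_attained:
  assumes "compact F" "F \<noteq> {}"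
  obtains z where "z \<in> F" "support_min F \<tau> = Re (\<tau> * z)"
proof -
  have "\<exists>z\<in>F. \<forall>w\<in>F. Re (\<tau> * z) \<le> Re (\<tau> * w)"
    using assms by (intro continuous_attains_inf continuous_intros)
  then obtain z where z: "z \<in> F" "\<And>w. w \<in> F \<Longrightarrow> Re (\<tau> * z) \<le> Re (\<tau> * w)" by blast
  have "support_min F \<tau> = Re (\<tau> * z)"
    unfolding support_min_def by (rule cInf_eq_minimum) (use z in auto)
  with z(1) show thesis by (rule that)
qed

lemma support_min_le:
  assumes "compact F" "w \<in> F"
  shows "support_min F \<tau> \<le> Re (\<tau> * w)"
proof -
  have "compact ((\<lambda>z. Re (\<tau> * z)) ` F)"
    using assms(1) by (intro compact_continuous_image continuous_intros)
  then have "bdd_below ((\<lambda>z. Re (\<tau> * z)) ` F)"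
    by (intro bounded_imp_bdd_below compact_imp_bounded)
  then show ?thesis
    unfolding support_min_def using assms(2) by (rule cINF_lower)
qed

text \<open>
  Turning by a small angle \<open>s * x\<close> moves \<open>z\<close> by about \<open>- s * x * Im z\<close> in the real direction. Points
  with \<open>s * Im z < 0\<close> therefore gain, while the others start with a positive real part, which
  compactness keeps away from 0.
\<close>

lemma rotated_into_half_plane:
  assumes C: "compact C" and s: "s \<in> {1, -1::real}"
    and half: "\<And>z. z \<in> C \<Longrightarrow> 0 \<le> Re z" "\<And>z. z \<in> C \<Longrightarrow> Re z = 0 \<Longrightarrow> s * Im z < 0"
  shows "\<forall>\<^sub>F x in at_right 0. \<forall>z\<in>C. 0 < Re (cis (s * x) * z)"
proof -
  define C1 where "C1 = C \<inter> {z. 0 \<le> s * Im z}"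
  have "closed {z. 0 \<le> s * Im z}" by (intro closed_Collect_le continuous_intros)
  with C have "compact C1" unfolding C1_def by (rule compact_Int_closed)
  have "\<exists>m>0. \<forall>z\<in>C1. m \<le> Re z"
  proof (cases "C1 = {}")
    case False
    then have "\<exists>z\<in>C1. \<forall>w\<in>C1. Re z \<le> Re w"
      using \<open>compact C1\<close> by (intro continuous_attains_inf continuous_intros)
    then obtain z where z: "z \<in> C1" "\<forall>w\<in>C1. Re z \<le> Re w" by blast
    have "Re z \<noteq> 0" using half(2)[of z] z(1) unfolding C1_def by auto
    moreover have "0 \<le> Re z" using half(1)[of z] z(1) by (simp add: C1_def)
    ultimately show ?thesis using z(2) by (intro exI[of _ "Re z"]) auto
  qed (auto intro: exI[of _ 1])
  then obtain m where m: "m > 0" "\<And>z. z \<in> C1 \<Longrightarrow> m \<le> Re z" by blast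
  obtain B where B: "\<And>z. z \<in> C \<Longrightarrow> cmod z \<le> B"
    using compact_imp_bounded[OF C] unfolding bounded_iff by blast
  have "((\<lambda>x. cos x * m - sin x * B) \<longlongrightarrow> cos 0 * m - sin 0 * B) (at_right 0)"
    by (intro tendsto_intros)
  then have "\<forall>\<^sub>F x in at_right 0. 0 < cos x * m - sin x * B"
    by (rule order_tendstoD) (use m in simp)
  moreover have "\<forall>\<^sub>F x in at_right 0. x \<in> {0<..<pi/2}"
    by (rule eventually_at_right_real) simp
  ultimately show ?thesis
  proof eventually_elim
    case (elim x)
    have cs: "0 < cos x" "0 < sin x" using elim(2) by (auto intro: cos_gt_zero sin_gt_zero2)
    show ?case
    proof
      fix z assume z: "z \<in> C"
      have Re_eq: "Re (cis (s * x) * z) = cos x * Re z - sin x * (s * Im z)"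
        using s by auto
      show "0 < Re (cis (s * x) * z)"
      proof (cases "0 \<le> s * Im z")
        case True
        then have "cos x * m \<le> cos x * Re z" using m(2)[of z] z cs by (simp add: C1_def)
        moreover have "s * Im z \<le> B" using abs_Im_le_cmod[of z] B[OF z] s by auto
        then have "sin x * (s * Im z) \<le> sin x * B" using cs by simp
        ultimately show ?thesis using elim(1) Re_eq by linarith
      next
        case False
        then have "sin x * (s * Im z) < 0" using cs by (simp add: mult_pos_neg)
        moreover have "0 \<le> cos x * Re z" using half(1)[OF z] cs by simp
        ultimately show ?thesis using Re_eq by linarith
      qed
    qed
  qed
qed

lemma eventually_at_right_unique:
  assumes "\<forall>\<^sub>F x in at_right (0::real). f x = a" "\<forall>\<^sub>F x in at_right 0. f x = b"
  shows "a = b"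
proof -
  have "\<forall>\<^sub>F x in at_right (0::real). a = b" using assms by eventually_elim simp
  then show ?thesis by simp
qed

locale unique_fractal_system =
  fixes \<sigma> :: "'a::finite \<Rightarrow> 'a list" and \<beta> :: complex and \<Gamma> :: "complex ^ 'a"
  assumes nonempty: "\<sigma> a \<noteq> []"
    and expanding: "1 < cmod \<beta>"
    and unique: "unique_representation \<sigma> \<beta> \<Gamma>"
begin

abbreviation "F \<equiv> fractal \<sigma> \<beta> \<Gamma>"
abbreviation "F_sub \<equiv> subfractal \<sigma> \<beta> \<Gamma>"

lemma compact_fractal: "compact (F a)"
  using compact_seq_val_image[OF expanding, of \<Gamma> \<sigma> a UNIV] by (simp add: fractal_def)

lemma compact_subfractal: "compact (F_sub a l)"
  using compact_seq_val_image[OF expanding, of \<Gamma> \<sigma> a "{l}"] by (simp add: subfractal_def)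

lemma subfractal_nonempty:
  assumes "l \<in> labels_of \<sigma> a"
  shows "F_sub a l \<noteq> {}"
proof -
  obtain x where "x \<in> seqs \<sigma> a" "x 0 = l" using nonempty assms by (rule seqs_extend)
  then show ?thesis unfolding subfractal_def by blast
qed

lemma subfractal_subset: "F_sub a l \<subseteq> F a"
  unfolding fractal_def subfractal_def by blast

lemma fractal_nonempty: "F a \<noteq> {}"
  using labels_of_nonempty[of \<sigma> a, OF nonempty] subfractal_nonempty[of _ a] subfractal_subset[of a]
  by blast

lemma fractal_covered:
  assumes "z \<in> F a"
  obtains l where "l \<in> labels_of \<sigma> a" "z \<in> F_sub a l"
proof -
  obtain x where x: "x \<in> seqs \<sigma> a" "z = seq_val \<beta> \<Gamma> x"
    using assms unfolding fractal_def by (rule imageE)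
  from x(1) have "x 0 \<in> labels_of \<sigma> a" by (simp add: seqs_def)
  moreover from x have "z \<in> F_sub a (x 0)" by (simp add: subfractal_def)
  ultimately show thesis by (rule that)
qed

lemma support_min_subfractal_ge:
  assumes "l \<in> labels_of \<sigma> a"
  shows "support_min (F a) \<tau> \<le> support_min (F_sub a l) \<tau>"
proof -
  obtain z where "z \<in> F_sub a l" "support_min (F_sub a l) \<tau> = Re (\<tau> * z)"
    by (rule support_min_attained[OF compact_subfractal subfractal_nonempty[OF assms]])
  moreover from this(1) have "z \<in> F a" using subfractal_subset by blast
  ultimately show ?thesis using support_min_le[OF compact_fractal] by simp
qed

text \<open>
  These are the labels between which the definition of \<open>H\<close> leaves the choice in the direction \<open>\<tau>\<close>.
\<close>

definition minimisers :: "'a \<Rightarrow> complex \<Rightarrow> 'a label set" where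
  "minimisers a \<tau> = {l \<in> labels_of \<sigma> a. support_min (F a) \<tau> = support_min (F_sub a l) \<tau>}"

lemma minimiser_of_extreme:
  assumes "extreme_for (F a) \<tau> z" "l \<in> labels_of \<sigma> a" "z \<in> F_sub a l"
  shows "l \<in> minimisers a \<tau>"
proof -
  have "support_min (F_sub a l) \<tau> \<le> Re (\<tau> * z)"
    using compact_subfractal assms(3) by (rule support_min_le)
  then show ?thesis
    using support_min_subfractal_ge[OF assms(2), of \<tau>] assms(1,2)
    by (simp add: minimisers_def extreme_for_def)
qed

lemma minimisers_nonempty: "minimisers a \<tau> \<noteq> {}"
proof -
  obtain z where z: "z \<in> F a" "support_min (F a) \<tau> = Re (\<tau> * z)"
    by (rule support_min_attained[OF compact_fractal fractal_nonempty])
  obtain l where "l \<in> labels_of \<sigma> a" "z \<in> F_sub a l"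
    using z(1) by (rule fractal_covered)
  then have "l \<in> minimisers a \<tau>"
    using z by (intro minimiser_of_extreme[of a \<tau> z]) (simp_all add: extreme_for_def)
  then show ?thesis by blast
qed

text \<open>
  As \<open>\<tau>\<close> is turned a little towards the side \<open>s\<close>, the extreme points move to the end \<open>w\<close> of the
  extreme face for \<open>\<tau>\<close> at which \<open>s * Im (\<tau> * w)\<close> is largest. Since \<open>w\<close> has a unique
  representation, it lies in only one of the compact sets \<open>F_sub a l\<close>, and the other ones stay
  strictly behind \<open>w\<close>.
\<close>

lemma one_sided_minimiser:
  assumes \<tau>: "cmod \<tau> = 1" and s: "s \<in> {1, -1::real}"
  obtains l where "l \<in> minimisers a \<tau>"
    "\<forall>\<^sub>F x in at_right 0. minimisers a (\<tau> * cis (s * x)) = {l}"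
proof -
  define E where "E = F a \<inter> {z. Re (\<tau> * z) = support_min (F a) \<tau>}"
  have "closed {z. Re (\<tau> * z) = support_min (F a) \<tau>}"
    by (intro closed_Collect_eq continuous_intros)
  with compact_fractal have "compact E" unfolding E_def by (rule compact_Int_closed)
  moreover have "E \<noteq> {}"
  proof -
    obtain z where "z \<in> F a" "support_min (F a) \<tau> = Re (\<tau> * z)"
      by (rule support_min_attained[OF compact_fractal fractal_nonempty])
    then have "z \<in> E" by (simp add: E_def)
    then show ?thesis by blast
  qed
  ultimately have "\<exists>w\<in>E. \<forall>z\<in>E. s * Im (\<tau> * z) \<le> s * Im (\<tau> * w)"
    by (intro continuous_attains_sup continuous_intros)
  then obtain w where w: "w \<in> E" "\<And>z. z \<in> E \<Longrightarrow> s * Im (\<tau> * z) \<le> s * Im (\<tau> * w)" by blast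
  have wF: "w \<in> F a" and extreme: "extreme_for (F a) \<tau> w"
    using w(1) by (auto simp: E_def extreme_for_def)
  obtain l where l: "l \<in> labels_of \<sigma> a" "w \<in> F_sub a l" using fractal_covered[OF wF] .
  \<comment> \<open>The first entry of the unique representation of \<open>w\<close> is the label.\<close>
  have only: "l' = l" if l': "w \<in> F_sub a l'" for l'
  proof -
    have "\<exists>!x. x \<in> seqs \<sigma> a \<and> seq_val \<beta> \<Gamma> x = w"
      using unique extreme \<tau> unfolding unique_representation_def
      by (elim allE[of _ a] allE[of _ w] impE) (auto intro!: bexI[of _ \<tau>])
    moreover obtain x where "x \<in> seqs \<sigma> a" "x 0 = l" "seq_val \<beta> \<Gamma> x = w"
      using l(2) by (auto simp: subfractal_def)
    moreover obtain y where "y \<in> seqs \<sigma> a" "y 0 = l'" "seq_val \<beta> \<Gamma> y = w"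
      using l' by (auto simp: subfractal_def)
    ultimately show ?thesis by blast
  qed
  have behind: "\<forall>\<^sub>F x in at_right 0. l' \<notin> minimisers a (\<tau> * cis (s * x))"
    if l': "l' \<in> labels_of \<sigma> a - {l}" for l'
  proof -
    define C where "C = (\<lambda>z. \<tau> * (z - w)) ` F_sub a l'"
    have "compact C"
      unfolding C_def by (intro compact_continuous_image continuous_intros compact_subfractal)
    moreover have "0 \<le> Re y" if y: "y \<in> C" for y
    proof -
      obtain z where z: "z \<in> F_sub a l'" "y = \<tau> * (z - w)" using y by (auto simp: C_def)
      then have "support_min (F a) \<tau> \<le> Re (\<tau> * z)"
        by (intro support_min_le[OF compact_fractal] subsetD[OF subfractal_subset])
      moreover have "Re y = Re (\<tau> * z) - Re (\<tau> * w)"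
        unfolding z(2) by (simp add: algebra_simps)
      ultimately show ?thesis using w(1) by (simp add: E_def)
    qed
    moreover have "s * Im y < 0" if y: "y \<in> C" "Re y = 0" for y
    proof -
      obtain z where z: "z \<in> F_sub a l'" "y = \<tau> * (z - w)" using y(1) by (auto simp: C_def)
      have "Re y = Re (\<tau> * z) - Re (\<tau> * w)"
        unfolding z(2) by (simp add: algebra_simps)
      then have "Re (\<tau> * z) = Re (\<tau> * w)" using y(2) by simp
      then have "z \<in> E" using subsetD[OF subfractal_subset z(1)] w(1) by (simp add: E_def)
      then have "s * Im (\<tau> * z) \<le> s * Im (\<tau> * w)" by (rule w(2))
      moreover have "s * Im y = s * Im (\<tau> * z) - s * Im (\<tau> * w)"
        unfolding z(2) by (simp add: algebra_simps)
      ultimately have "s * Im y \<le> 0" by simp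
      moreover have "z \<noteq> w" using only[of l'] l' z(1) by blast
      then have "y \<noteq> 0" using z(2) \<tau> by auto
      then have "Im y \<noteq> 0" using y(2) by (simp add: complex_eq_iff)
      ultimately show ?thesis using s by auto
    qed
    ultimately have "\<forall>\<^sub>F x in at_right 0. \<forall>y\<in>C. 0 < Re (cis (s * x) * y)"
      by (rule rotated_into_half_plane[OF _ s])
    then show ?thesis
    proof eventually_elim
      case (elim x)
      let ?\<tau> = "\<tau> * cis (s * x)"
      have "l' \<in> labels_of \<sigma> a" using l' by simp
      then obtain z where z: "z \<in> F_sub a l'" "support_min (F_sub a l') ?\<tau> = Re (?\<tau> * z)"
        by (rule support_min_attained[OF compact_subfractal subfractal_nonempty])
      have "0 < Re (cis (s * x) * (\<tau> * (z - w)))" using elim z(1) by (auto simp: C_def)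
      moreover have "cis (s * x) * (\<tau> * (z - w)) = ?\<tau> * z - ?\<tau> * w" by (simp only: algebra_simps)
      ultimately have "Re (?\<tau> * w) < Re (?\<tau> * z)"
        by (simp only: minus_complex.sel diff_gt_0_iff_gt)
      moreover have "support_min (F a) ?\<tau> \<le> Re (?\<tau> * w)"
        using compact_fractal wF by (rule support_min_le)
      ultimately show ?case using z(2) by (simp add: minimisers_def)
    qed
  qed
  show thesis
  proof (rule that)
    show "l \<in> minimisers a \<tau>" using minimiser_of_extreme[OF extreme l] .
    have "\<forall>\<^sub>F x in at_right 0. \<forall>l'\<in>labels_of \<sigma> a - {l}. l' \<notin> minimisers a (\<tau> * cis (s * x))"
      using behind finite_labels_of by (intro eventually_ball_finite) auto
    then show "\<forall>\<^sub>F x in at_right 0. minimisers a (\<tau> * cis (s * x)) = {l}"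
    proof eventually_elim
      case (elim x)
      then have "minimisers a (\<tau> * cis (s * x)) \<subseteq> {l}" unfolding minimisers_def by blast
      then show ?case using minimisers_nonempty by blast
    qed
  qed
qed

section \<open>The map \<open>H\<close> on the circles\<close>

definition next_label :: "'a \<Rightarrow> complex \<Rightarrow> 'a label" where
  "next_label a \<tau> = (THE l. \<forall>\<^sub>F x in at_right 0. minimisers a (\<tau> * cis x) = {l})"

lemma next_label:
  assumes "cmod \<tau> = 1"
  shows "next_label a \<tau> \<in> minimisers a \<tau>"
    and "\<forall>\<^sub>F x in at_right 0. minimisers a (\<tau> * cis x) = {next_label a \<tau>}"
proof -
  obtain l where l: "l \<in> minimisers a \<tau>" "\<forall>\<^sub>F x in at_right 0. minimisers a (\<tau> * cis (1 * x)) = {l}"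
    by (rule one_sided_minimiser[OF assms, of 1]) auto
  have ev: "\<forall>\<^sub>F x in at_right 0. minimisers a (\<tau> * cis x) = {l}" using l(2) by simp
  have "next_label a \<tau> = l"
    unfolding next_label_def
  proof (rule the_equality)
    show "l' = l" if "\<forall>\<^sub>F x in at_right 0. minimisers a (\<tau> * cis x) = {l'}" for l'
      using eventually_at_right_unique[OF that ev] by simp
  qed (rule ev)
  with l(1) ev show "next_label a \<tau> \<in> minimisers a \<tau>"
    "\<forall>\<^sub>F x in at_right 0. minimisers a (\<tau> * cis x) = {next_label a \<tau>}" by simp_all
qed

lemma next_label_eq:
  assumes "cmod \<tau> = 1" "minimisers a \<tau> = {l}"
  shows "next_label a \<tau> = l"
  using next_label(1)[OF assms(1), of a] assms(2) by simp

lemma next_label_right_continuous: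
  assumes "cmod \<tau> = 1"
  shows "\<forall>\<^sub>F x in at_right 0. next_label a (\<tau> * cis x) = next_label a \<tau>"
  using next_label(2)[OF assms, of a]
  by eventually_elim (rule next_label_eq, simp_all add: norm_mult assms)

lemma next_label_one_sided_limit:
  assumes "cmod \<tau> = 1" "s \<in> {1, -1::real}"
  shows "\<exists>l. \<forall>\<^sub>F x in at_right 0. next_label a (\<tau> * cis (s * x)) = l"
proof -
  obtain l where "\<forall>\<^sub>F x in at_right 0. minimisers a (\<tau> * cis (s * x)) = {l}"
    by (rule one_sided_minimiser[OF assms])
  then have "\<forall>\<^sub>F x in at_right 0. next_label a (\<tau> * cis (s * x)) = l"
    by eventually_elim (rule next_label_eq, simp_all add: norm_mult assms)
  then show ?thesis by blast
qed

lemma next_label_in: "cmod \<tau> = 1 \<Longrightarrow> next_label a \<tau> \<in> labels_of \<sigma> a"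
  using next_label(1)[of \<tau> a] by (simp add: minimisers_def)

text \<open>
  To the right of every direction there is exactly one legitimate label, so right-continuity
  leaves no freedom for \<open>H\<close>.
\<close>

lemma H_map_eq:
  "H_map \<sigma> \<beta> \<Gamma> = restrict (\<lambda>(\<tau>, k). (inverse (direction \<beta>) * \<tau>, next_label (fst (snd k)) \<tau>)) (X_space \<sigma>)"
    (is "_ = ?H")
  unfolding H_map_def
proof (rule the_equality)
  have H: "?H (\<tau>, k) = (inverse (direction \<beta>) * \<tau>, next_label (fst (snd k)) \<tau>)"
    if "cmod \<tau> = 1" "k \<in> labels \<sigma>" for \<tau> k
    using that by (simp add: X_space_def)
  show "is_H_map \<sigma> \<beta> \<Gamma> ?H"
    unfolding is_H_map_def
  proof (intro conjI allI impI)
    fix \<tau> q a r assume "(\<tau>, (q, a, r)) \<in> X_space \<sigma>"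
    then have \<tau>: "cmod \<tau> = 1" and k: "(q, a, r) \<in> labels \<sigma>" by (simp_all add: X_space_def)
    show "\<exists>l\<in>labels_of \<sigma> a. support_min (F a) \<tau> = support_min (F_sub a l) \<tau> \<and>
        ?H (\<tau>, (q, a, r)) = (inverse (direction \<beta>) * \<tau>, l)"
      using next_label(1)[OF \<tau>, of a] H[OF \<tau> k]
      by (intro bexI[of _ "next_label a \<tau>"] conjI) (simp_all add: minimisers_def)
  next
    fix \<tau> k assume "(\<tau>, k) \<in> X_space \<sigma>"
    then have \<tau>: "cmod \<tau> = 1" and k: "k \<in> labels \<sigma>" by (simp_all add: X_space_def)
    show "\<forall>\<^sub>F x in at_right 0. snd (?H (\<tau> * cis x, k)) = snd (?H (\<tau>, k))"
      using next_label_right_continuous[OF \<tau>, of "fst (snd k)"]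
      by eventually_elim (use H \<tau> k in \<open>simp add: norm_mult\<close>)
  qed simp
  show "G = ?H" if G: "is_H_map \<sigma> \<beta> \<Gamma> G" for G
  proof (rule extensionalityI[of _ "X_space \<sigma>"])
    show "G \<in> extensional (X_space \<sigma>)" using G by (simp add: is_H_map_def)
    show "G p = ?H p" if p: "p \<in> X_space \<sigma>" for p
    proof -
      have minimising: "fst (G (\<tau>, k)) = inverse (direction \<beta>) * \<tau>"
        "snd (G (\<tau>, k)) \<in> minimisers (fst (snd k)) \<tau>"
        if \<tau>: "cmod \<tau> = 1" and k: "k \<in> labels \<sigma>" for \<tau> k
      proof -
        obtain q a r where qar: "k = (q, a, r)" by (cases k)
        have "(\<tau>, (q, a, r)) \<in> X_space \<sigma>" using \<tau> k qar by (simp add: X_space_def)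
        then obtain l where "l \<in> labels_of \<sigma> a" "support_min (F a) \<tau> = support_min (F_sub a l) \<tau>"
          "G (\<tau>, (q, a, r)) = (inverse (direction \<beta>) * \<tau>, l)"
          using G unfolding is_H_map_def by blast
        then show "fst (G (\<tau>, k)) = inverse (direction \<beta>) * \<tau>"
          "snd (G (\<tau>, k)) \<in> minimisers (fst (snd k)) \<tau>"
          by (simp_all add: qar minimisers_def)
      qed
      obtain \<tau> k where p_eq: "p = (\<tau>, k)" and \<tau>: "cmod \<tau> = 1" and k: "k \<in> labels \<sigma>"
        using p by (auto simp: X_space_def)
      have "\<forall>\<^sub>F x in at_right 0. snd (G (\<tau> * cis x, k)) = next_label (fst (snd k)) \<tau>"
        using next_label(2)[OF \<tau>, of "fst (snd k)"]
      proof eventually_elim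
        case (elim x)
        have "cmod (\<tau> * cis x) = 1" using \<tau> by (simp add: norm_mult)
        from minimising(2)[OF this k] elim show ?case by simp
      qed
      moreover have "\<forall>\<^sub>F x in at_right 0. snd (G (\<tau> * cis x, k)) = snd (G (\<tau>, k))"
        using G p p_eq unfolding is_H_map_def by blast
      ultimately have "snd (G (\<tau>, k)) = next_label (fst (snd k)) \<tau>"
        by (rule eventually_at_right_unique[rotated])
      then show ?thesis
        using minimising(1)[OF \<tau> k] H[OF \<tau> k] by (simp add: p_eq prod_eq_iff)
    qed
  qed simp
qed

lemma H_map_apply:
  assumes "cmod \<tau> = 1" "k \<in> labels \<sigma>"
  shows "H_map \<sigma> \<beta> \<Gamma> (\<tau>, k) = (inverse (direction \<beta>) * \<tau>, next_label (fst (snd k)) \<tau>)"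
  using assms by (simp add: H_map_eq X_space_def)

end

section \<open>The map \<open>H\<close> on the interval\<close>

lemma eventually_at_right_scale:
  assumes "0 < (c::real)" "\<forall>\<^sub>F x in at_right 0. P x"
  shows "\<forall>\<^sub>F x in at_right 0. P (c * x)"
proof -
  obtain b where b: "b > 0" "\<And>y. 0 < y \<Longrightarrow> y < b \<Longrightarrow> P y"
    using assms(2) unfolding eventually_at_right_field by blast
  have "\<forall>\<^sub>F x in at_right 0. x \<in> {0<..<b / c}"
    by (rule eventually_at_right_real) (use assms(1) b in simp)
  then show ?thesis
    by eventually_elim (use assms(1) b(2) in \<open>simp add: field_simps\<close>)
qed

lemma frac_eq_shift:
  assumes "frac (u - c) = frac (w - c)"
  shows "frac u = frac w"
proof -
  have "u = w + of_int (\<lfloor>u - c\<rfloor> - \<lfloor>w - c\<rfloor>)" using assms by (simp add: frac_def)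
  then obtain m :: int where "u = w + of_int m" ..
  then show ?thesis by (simp add: frac_def)
qed

lemma cis_frac: "cis (2 * pi * frac u) = cis (2 * pi * u)"
proof -
  have "cis (2 * pi * u) = cis (2 * pi * frac u) * cis (2 * pi * of_int \<lfloor>u\<rfloor>)"
    unfolding cis_mult by (simp add: frac_def algebra_simps)
  then show ?thesis by (simp add: cis_multiple_2pi)
qed

lemma Arg2pi_cis_frac: "Arg2pi (cis (2 * pi * u)) = 2 * pi * frac u"
proof (rule Arg2pi_unique[of 1])
  show "of_real 1 * exp (\<i> * of_real (2 * pi * frac u)) = cis (2 * pi * u)"
    by (simp only: cis_conv_exp[symmetric] cis_frac of_real_1 mult_1)
qed (simp_all add: frac_lt_1)

lemma unit_complex_cis:
  assumes "cmod \<tau> = 1"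
  obtains u where "\<tau> = cis (2 * pi * u)"
proof -
  have "\<tau> = exp (\<i> * of_real (Arg2pi \<tau>))" using Arg2pi_eq[of \<tau>] assms by simp
  then have "\<tau> = cis (2 * pi * (Arg2pi \<tau> / (2 * pi)))" by (simp add: cis_conv_exp)
  then show thesis by (rule that)
qed

locale fractal_interval_map = unique_fractal_system \<sigma> \<beta> \<Gamma>
  for \<sigma> :: "'a::finite \<Rightarrow> 'a list" and \<beta> \<Gamma> +
  fixes pos :: "'a label \<Rightarrow> nat" and \<rho> :: real
  assumes pos: "bij_betw pos (labels \<sigma>) {..<card (labels \<sigma>)}"
    and direction_eq: "direction \<beta> = cis (2 * pi * \<rho>)"
    and irrational: "\<rho> \<notin> \<rat>"
begin

abbreviation "L \<equiv> labels \<sigma>"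
abbreviation "N \<equiv> card (labels \<sigma>)"
abbreviation "h \<equiv> H_ivl \<sigma> \<beta> \<Gamma> pos"

definition label_step :: "real \<Rightarrow> 'a label \<Rightarrow> 'a label" where
  "label_step u k = next_label (fst (snd k)) (cis (2 * pi * u))"

definition ivl_point :: "'a label \<Rightarrow> real \<Rightarrow> real" where
  "ivl_point k u = (real (pos k) + frac u) / real N"

lemma N_pos: "0 < N"
  using labels_of_nonempty[of \<sigma> undefined, OF nonempty] labels_of_subset[of \<sigma> undefined]
  by (simp add: card_gt_0_iff finite_labels) blast

lemma pos_surj:
  assumes "m < N"
  obtains k where "k \<in> L" "pos k = m"
proof -
  have "m \<in> pos ` L" using assms bij_betw_imp_surj_on[OF pos] by simp
  then show thesis by (rule imageE) (rule that, simp_all)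
qed

lemma pos_less: "k \<in> L \<Longrightarrow> pos k < N"
  using pos by (auto dest: bij_betwE)

lemma circle_to_ivl_cis: "circle_to_ivl \<sigma> pos (cis (2 * pi * u), k) = ivl_point k u"
  by (simp add: circle_to_ivl_def ivl_point_def Arg2pi_cis_frac)

lemma ivl_point_in: "k \<in> L \<Longrightarrow> 0 \<le> ivl_point k u \<and> ivl_point k u < 1"
proof -
  assume "k \<in> L"
  then have "real (pos k) + 1 \<le> real N" using pos_less[of k] by linarith
  then have "real (pos k) + frac u < real N" using frac_lt_1[of u] by linarith
  then show ?thesis using N_pos by (simp add: ivl_point_def)
qed

lemma ivl_point_inject:
  assumes "k \<in> L" "k' \<in> L" "ivl_point k u = ivl_point k' u'"
  shows "k = k' \<and> frac u = frac u'"
proof -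
  have eq: "real (pos k) + frac u = real (pos k') + frac u'"
    using assms(3) N_pos by (simp add: ivl_point_def)
  have "\<lfloor>real n + frac v\<rfloor> = int n" for n v by (rule floor_unique) (simp_all add: frac_lt_1)
  from this[of "pos k" u] this[of "pos k'" u'] have "pos k = pos k'" by (simp add: eq)
  then have "k = k'" using inj_onD[OF bij_betw_imp_inj_on[OF pos]] assms(1,2) by blast
  with eq show ?thesis by simp
qed

lemma ivl_point_surj:
  assumes "0 \<le> t" "t < 1"
  obtains k u where "k \<in> L" "0 \<le> u" "u < 1" "t = (real (pos k) + u) / real N" "t = ivl_point k u"
proof -
  have "\<lfloor>t * real N\<rfloor> < int N" using assms N_pos by (simp add: floor_less_iff)
  then have "nat \<lfloor>t * real N\<rfloor> < N" using assms by (simp add: nat_less_iff)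
  then obtain k where k: "k \<in> L" "pos k = nat \<lfloor>t * real N\<rfloor>" by (rule pos_surj)
  have pk: "real (pos k) = real_of_int \<lfloor>t * real N\<rfloor>" using k(2) assms by simp
  show thesis
  proof (rule that[OF k(1), of "frac (t * real N)"])
    show "t = (real (pos k) + frac (t * real N)) / real N" using N_pos by (simp add: pk frac_def)
    then show "t = ivl_point k (frac (t * real N))" by (simp add: ivl_point_def)
  qed (simp_all add: frac_lt_1)
qed

lemma ivl_point_left_surj:
  assumes "0 < t" "t \<le> 1"
  obtains k u where "k \<in> L" "0 < u" "u \<le> 1" "t = (real (pos k) + u) / real N"
proof -
  define m where "m = \<lceil>t * real N\<rceil> - 1"
  have tN: "0 < t * real N" "t * real N \<le> real N" using assms N_pos by simp_all
  have m: "0 \<le> m" "m < int N" using tN unfolding m_def by linarith+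
  have "nat m < N" using m by (simp add: nat_less_iff)
  then obtain k where k: "k \<in> L" "pos k = nat m" by (rule pos_surj)
  have pk: "real (pos k) = real_of_int m" using k(2) m by simp
  show thesis
  proof (rule that[OF k(1), of "t * real N - real_of_int m"])
    show "0 < t * real N - real_of_int m" "t * real N - real_of_int m \<le> 1"
      unfolding m_def by linarith+
    show "t = (real (pos k) + (t * real N - real_of_int m)) / real N" using N_pos by (simp add: pk)
  qed
qed

lemma label_step_in: "label_step u k \<in> L"
  using next_label_in[of "cis (2 * pi * u)" "fst (snd k)"] labels_of_subset[of \<sigma>]
  by (auto simp: label_step_def)

lemma label_step_periodic: "frac u = frac v \<Longrightarrow> label_step u = label_step v"
  unfolding label_step_def by (metis cis_frac)

lemma H_ivl_point:
  assumes k: "k \<in> L"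
  shows "h (ivl_point k u) = ivl_point (label_step u k) (u - \<rho>)"
proof -
  have inj: "inj_on (circle_to_ivl \<sigma> pos) (X_space \<sigma>)"
  proof (rule inj_onI, clarify)
    fix \<tau> k \<tau>' k'
    assume X: "(\<tau>, k) \<in> X_space \<sigma>" "(\<tau>', k') \<in> X_space \<sigma>"
      and eq: "circle_to_ivl \<sigma> pos (\<tau>, k) = circle_to_ivl \<sigma> pos (\<tau>', k')"
    have "cmod \<tau> = 1" "cmod \<tau>' = 1" using X by (simp_all add: X_space_def)
    then obtain u u' where u: "\<tau> = cis (2 * pi * u)" "\<tau>' = cis (2 * pi * u')"
      by (elim unit_complex_cis) blast
    have "k = k' \<and> frac u = frac u'"
      using X eq by (intro ivl_point_inject) (simp_all add: X_space_def u circle_to_ivl_cis)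
    then show "\<tau> = \<tau>' \<and> k = k'" unfolding u using cis_frac[of u] cis_frac[of u'] by simp
  qed
  have "inv_into (X_space \<sigma>) (circle_to_ivl \<sigma> pos) (ivl_point k u) = (cis (2 * pi * u), k)"
    using inj by (rule inv_into_f_eq) (simp_all add: X_space_def k circle_to_ivl_cis)
  moreover have "inverse (direction \<beta>) * cis (2 * pi * u) = cis (2 * pi * (u - \<rho>))"
    by (simp add: direction_eq cis_mult algebra_simps)
  ultimately show ?thesis
    by (simp add: H_ivl_def H_map_apply k label_step_def[symmetric] circle_to_ivl_cis)
qed

lemma H_ivl_in:
  assumes "0 \<le> t" "t < 1"
  shows "0 \<le> h t \<and> h t < 1"
proof -
  obtain k u where "k \<in> L" "t = ivl_point k u" using assms by (rule ivl_point_surj)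
  then show ?thesis by (simp add: H_ivl_point ivl_point_in label_step_in)
qed

lemma label_step_one_sided_limit:
  assumes s: "s \<in> {1, -1::real}"
  shows "\<exists>a. \<forall>\<^sub>F x in at_right 0. \<forall>k\<in>L. label_step (u + s * x) k = a k"
proof -
  have "\<forall>k. \<exists>l. \<forall>\<^sub>F x in at_right 0. label_step (u + s * x) k = l"
  proof
    fix k :: "'a label"
    have "\<exists>l. \<forall>\<^sub>F x in at_right 0. next_label (fst (snd k)) (cis (2 * pi * u) * cis (s * x)) = l"
      by (rule next_label_one_sided_limit) (use s in simp_all)
    then obtain l where
      "\<forall>\<^sub>F x in at_right 0. next_label (fst (snd k)) (cis (2 * pi * u) * cis (s * x)) = l" ..
    then have "\<forall>\<^sub>F x in at_right 0. next_label (fst (snd k)) (cis (2 * pi * u) * cis (s * (2 * pi * x))) = l"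
      by (intro eventually_at_right_scale[of "2 * pi"]) simp_all
    moreover have "cis (2 * pi * u) * cis (s * (2 * pi * x)) = cis (2 * pi * (u + s * x))" for x
      by (simp add: cis_mult algebra_simps)
    ultimately show "\<exists>l. \<forall>\<^sub>F x in at_right 0. label_step (u + s * x) k = l"
      by (intro exI[of _ l]) (simp add: label_step_def)
  qed
  from choice[OF this] obtain a where "\<forall>k. \<forall>\<^sub>F x in at_right 0. label_step (u + s * x) k = a k" ..
  then have "\<forall>\<^sub>F x in at_right 0. \<forall>k\<in>L. label_step (u + s * x) k = a k"
    by (intro eventually_ball_finite finite_labels ballI) (erule spec)
  then show ?thesis by (intro exI[of _ a])
qed

lemma label_step_right_continuous: "\<forall>\<^sub>F x in at_right 0. label_step (u + x) k = label_step u k"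
proof -
  have "\<forall>\<^sub>F x in at_right 0.
      next_label (fst (snd k)) (cis (2 * pi * u) * cis (2 * pi * x)) = label_step u k"
    unfolding label_step_def
    by (rule eventually_at_right_scale[of "2 * pi" "\<lambda>y. next_label _ (cis (2 * pi * u) * cis y) = _"])
      (simp_all add: next_label_right_continuous)
  moreover have "cis (2 * pi * u) * cis (2 * pi * x) = cis (2 * pi * (u + x))" for x
    by (simp add: cis_mult algebra_simps)
  ultimately show ?thesis by (simp add: label_step_def)
qed

sublocale irrational_skew_product "labels \<sigma>" label_step \<rho>
  by unfold_locales (simp_all add: finite_labels irrational label_step_in label_step_one_sided_limit)

lemma ivl_point_right: "\<forall>\<^sub>F x in at_right 0. ivl_point k (u + x) = ivl_point k u + x / real N"
proof -
  have "\<forall>\<^sub>F x in at_right 0. x \<in> {0<..<1 - frac u}"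
    by (rule eventually_at_right_real) (simp add: frac_lt_1)
  then show ?thesis
  proof eventually_elim
    case (elim x)
    have "u + x - (frac u + x) \<in> \<int>" by (simp add: frac_def)
    moreover have "0 \<le> frac u + x" using elim by simp
    ultimately have "frac (u + x) = frac u + x" using elim by (subst frac_unique_iff) auto
    then show ?case by (simp add: ivl_point_def add_divide_distrib)
  qed
qed

lemma ivl_point_left: "\<exists>e. \<forall>\<^sub>F x in at_right 0. ivl_point k (u - x) = e - x / real N"
proof -
  define c where "c = u - of_int (\<lceil>u\<rceil> - 1)"
  have "0 < c" unfolding c_def by linarith
  then have "\<forall>\<^sub>F x in at_right 0. x \<in> {0<..<c}" by (rule eventually_at_right_real)
  then have "\<forall>\<^sub>F x in at_right 0. ivl_point k (u - x) = (real (pos k) + c) / real N - x / real N"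
  proof eventually_elim
    case (elim x)
    have "u - x - (c - x) \<in> \<int>" by (simp add: c_def)
    moreover have "c \<le> 1" unfolding c_def by linarith
    ultimately have "frac (u - x) = c - x" using elim by (subst frac_unique_iff) auto
    then show ?case by (simp add: ivl_point_def add_divide_distrib diff_divide_distrib)
  qed
  then show ?thesis by blast
qed

text \<open>
  An arbitrary function \<open>S\<close> of the angle with one-sided limits is carried along, so that later one
  interval serves both for \<open>h\<close> and for the fibres of a minimal component.
\<close>

lemma right_neighbourhood:
  assumes S: "\<And>u. \<forall>\<^sub>F x in at_right 0. S (u + x) = S u" and t: "0 \<le> t" "t < 1"
  obtains k u e d where "k \<in> L" "e > 0"
    "\<And>t'. t \<le> t' \<Longrightarrow> t' < t + e \<Longrightarrow> \<exists>v. t' = ivl_point k v \<and> S v = S u"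
    "\<And>t'. t \<le> t' \<Longrightarrow> t' < t + e \<Longrightarrow> h t' = t' + d"
proof -
  obtain k u where k: "k \<in> L" and tu: "t = ivl_point k u" using t by (rule ivl_point_surj)
  define d where "d = ivl_point (label_step u k) (u - \<rho>) - t"
  have "\<forall>\<^sub>F x in at_right 0. ivl_point k (u + x) = t + x / real N \<and> S (u + x) = S u \<and>
      h (t + x / real N) = t + x / real N + d"
    using S[of u] ivl_point_right[of k u] label_step_right_continuous[of u k]
      ivl_point_right[of "label_step u k" "u - \<rho>"]
  proof eventually_elim
    case (elim x)
    have "h (ivl_point k (u + x)) = ivl_point (label_step u k) (u + x - \<rho>)"
      using elim(3) by (simp add: H_ivl_point k)
    moreover have "u + x - \<rho> = u - \<rho> + x" by simp
    ultimately show ?case using elim by (simp add: tu d_def)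
  qed
  then obtain e where e: "e > 0" "\<And>x. 0 < x \<Longrightarrow> x < e \<Longrightarrow> ivl_point k (u + x) = t + x / real N \<and>
      S (u + x) = S u \<and> h (t + x / real N) = t + x / real N + d"
    unfolding eventually_at_right_field by blast
  have e0: "ivl_point k (u + x) = t + x / real N \<and> S (u + x) = S u \<and>
      h (t + x / real N) = t + x / real N + d" if "0 \<le> x" "x < e" for x
  proof (cases "x = 0")
    case True
    then show ?thesis by (simp add: tu d_def H_ivl_point k)
  qed (use e(2) that in simp)
  show thesis
  proof (rule that[OF k, of "e / real N" u d])
    show "e / real N > 0" using e(1) N_pos by simp
    fix t' assume t': "t \<le> t'" "t' < t + e / real N"
    define x where "x = (t' - t) * real N"
    have x: "0 \<le> x" "x < e" "t + x / real N = t'"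
      using t' N_pos by (simp_all add: x_def field_simps)
    from e0[OF x(1,2)] have e': "ivl_point k (u + x) = t'" "S (u + x) = S u" "h t' = t' + d"
      unfolding x(3) by blast+
    then show "\<exists>v. t' = ivl_point k v \<and> S v = S u" by (intro exI[of _ "u + x"]) simp
    show "h t' = t' + d" by (rule e'(3))
  qed
qed

lemma left_neighbourhood:
  assumes S: "\<And>u. \<exists>A. \<forall>\<^sub>F x in at_right 0. S (u - x) = A" and t: "0 < t" "t \<le> 1"
  obtains k A e d where "k \<in> L" "e > 0"
    "\<And>t'. t - e \<le> t' \<Longrightarrow> t' < t \<Longrightarrow> \<exists>v. t' = ivl_point k v \<and> S v = A"
    "\<And>t'. t - e \<le> t' \<Longrightarrow> t' < t \<Longrightarrow> h t' = t' + d"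
proof -
  \<comment> \<open>A point between two circles is reached from the left along the first one, with \<open>u = 1\<close>.\<close>
  obtain k u where k: "k \<in> L" and u: "0 < u" "u \<le> 1" and tu: "t = (real (pos k) + u) / real N"
    using t by (rule ivl_point_left_surj)
  obtain A where A: "\<forall>\<^sub>F x in at_right 0. S (u - x) = A" using S by blast
  obtain b where b: "\<forall>\<^sub>F x in at_right 0. \<forall>k\<in>L. label_step (u + (-1) * x) k = b k"
    using label_step_one_sided_limit[of "-1" u] by blast
  obtain c where c: "\<forall>\<^sub>F x in at_right 0. ivl_point (b k) (u - \<rho> - x) = c - x / real N"
    using ivl_point_left by blast
  have "\<forall>\<^sub>F x in at_right 0. x \<in> {0<..<u}" using u(1) by (rule eventually_at_right_real)
  then have "\<forall>\<^sub>F x in at_right 0. ivl_point k (u - x) = t - x / real N \<and> S (u - x) = A \<and>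
      h (t - x / real N) = t - x / real N + (c - t)"
    using A b c
  proof eventually_elim
    case (elim x)
    have "frac (u - x) = u - x" using elim(1) u by (simp add: frac_eq)
    then have point: "ivl_point k (u - x) = t - x / real N"
      by (simp add: ivl_point_def tu add_divide_distrib diff_divide_distrib)
    have "h (ivl_point k (u - x)) = ivl_point (b k) (u - x - \<rho>)"
      using elim(3) k by (simp add: H_ivl_point)
    moreover have "u - x - \<rho> = u - \<rho> - x" by simp
    ultimately show ?case using elim point by simp
  qed
  then obtain e where e: "e > 0" "\<And>x. 0 < x \<Longrightarrow> x < e \<Longrightarrow> ivl_point k (u - x) = t - x / real N \<and>
      S (u - x) = A \<and> h (t - x / real N) = t - x / real N + (c - t)"
    unfolding eventually_at_right_field by blast
  \<comment> \<open>Half of \<open>e\<close>, because the left end point of the interval has to be included.\<close>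
  show thesis
  proof (rule that[OF k, of "e / (2 * real N)" A "c - t"])
    show "e / (2 * real N) > 0" using e(1) N_pos by simp
    fix t' assume t': "t - e / (2 * real N) \<le> t'" "t' < t"
    define x where "x = (t - t') * real N"
    have "x \<le> e / 2" using t'(1) N_pos by (simp add: x_def field_simps)
    then have x: "0 < x" "x < e" "t - x / real N = t'"
      using t'(2) N_pos e(1) by (simp_all add: x_def)
    from e(2)[OF x(1,2)] have e': "ivl_point k (u - x) = t'" "S (u - x) = A" "h t' = t' + (c - t)"
      unfolding x(3) by blast+
    then show "\<exists>v. t' = ivl_point k v \<and> S v = A" by (intro exI[of _ "u - x"]) simp
    show "h t' = t' + (c - t)" by (rule e'(3))
  qed
qed

section \<open>The minimal components\<close>

definition fibre :: "real set \<Rightarrow> real \<Rightarrow> 'a label set" where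
  "fibre J u = {k \<in> L. ivl_point k u \<in> J}"

lemma ivl_point_in_iff: "k \<in> L \<Longrightarrow> ivl_point k u \<in> J \<longleftrightarrow> k \<in> fibre J u"
  by (simp add: fibre_def)

lemma ivl_point_cong: "frac u = frac v \<Longrightarrow> ivl_point k u = ivl_point k v"
  by (simp add: ivl_point_def)

lemma H_ivl_left_end: "\<exists>d. \<forall>\<^sub>F t in at_left 1. h t = t + d"
proof -
  obtain k e d where "e > 0" "\<And>t'. 1 - e \<le> t' \<Longrightarrow> t' < 1 \<Longrightarrow> h t' = t' + d"
    by (rule left_neighbourhood[of "\<lambda>_. ()" 1]) auto
  then show ?thesis
    unfolding eventually_at_left_field by (intro exI[of _ d] exI[of _ "1 - e"]) auto
qed

text \<open>
  Invariance of \<open>J\<close> under \<open>h\<close> and closedness of its split version become the two hypotheses on the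
  fibres over the circle.
\<close>

lemma minimal_component_invariant:
  assumes "minimal_component h J"
  shows "J \<subseteq> unit_ivl" "h ` J = J" "invariant_fibres L label_step \<rho> (fibre J)"
proof -
  obtain K where K: "hat_minimal_component h K" and J: "J = {t \<in> unit_ivl. Pt t \<in> K}"
    using assms unfolding minimal_component_def by blast
  show J01: "J \<subseteq> unit_ivl" using J by blast
  obtain d where d: "\<forall>\<^sub>F t in at_left 1. h t = t + d" using H_ivl_left_end by blast
  have closed: "closedin (hat_top h) K" and inv: "hat_map h ` K = K"
    using K by (simp_all add: hat_minimal_component_def)
  show hJ: "h ` J = J"
    unfolding J
    using H_ivl_in d closedin_subset[OF closed, unfolded topspace_hat_top] inv
    by (rule ordinary_part_invariant)
  show "invariant_fibres L label_step \<rho> (fibre J)"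
  proof unfold_locales
    show "fibre J u \<subseteq> L" for u by (auto simp: fibre_def)
    show "fibre J (u + of_int m) = fibre J u" for u m
      unfolding fibre_def using ivl_point_cong[of "u + of_int m" u] by simp
    show "fibre J (u - \<rho>) = label_step u ` fibre J u" for u
    proof (rule antisym; rule subsetI)
      fix l assume l: "l \<in> fibre J (u - \<rho>)"
      then have lL: "l \<in> L" and "ivl_point l (u - \<rho>) \<in> h ` J" by (simp_all add: fibre_def hJ)
      then obtain t where t: "t \<in> J" "ivl_point l (u - \<rho>) = h t" by blast
      have "0 \<le> t" "t < 1" using t(1) J01 by auto
      then obtain k w where k: "k \<in> L" "t = ivl_point k w" by (rule ivl_point_surj)
      have "ivl_point l (u - \<rho>) = ivl_point (label_step w k) (w - \<rho>)"
        using t(2) k by (simp add: H_ivl_point)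
      then have lk: "l = label_step w k" "frac (u - \<rho>) = frac (w - \<rho>)"
        using ivl_point_inject[OF lL label_step_in] by blast+
      from lk(2) have "frac u = frac w" by (rule frac_eq_shift)
      then have "l = label_step u k" "ivl_point k u \<in> J"
        using lk(1) label_step_periodic[of u w] ivl_point_cong[of u w k] t(1) k(2) by simp_all
      then show "l \<in> label_step u ` fibre J u" using k(1) by (simp add: fibre_def)
    next
      fix l assume "l \<in> label_step u ` fibre J u"
      then obtain k where k: "k \<in> L" "ivl_point k u \<in> J" "l = label_step u k"
        by (auto simp: fibre_def)
      have "h (ivl_point k u) \<in> J" using hJ k(2) by blast
      then show "l \<in> fibre J (u - \<rho>)"
        using k by (simp add: fibre_def H_ivl_point label_step_in)
    qed
    show "\<forall>\<^sub>F x in at_right 0. k \<notin> fibre J (u + x)" if k: "k \<notin> fibre J u" for k u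
    proof (cases "k \<in> L")
      case True
      let ?t = "ivl_point k u"
      have t: "0 \<le> ?t" "?t < 1" using ivl_point_in[OF True, of u] by simp_all
      have "Pt ?t \<notin> K" using k True t by (simp add: fibre_def J)
      then have "\<forall>\<^sub>F s in at_right ?t. Pt s \<notin> K" using closedin_hat_right[OF closed t] by blast
      then obtain b where b: "b > ?t" "\<And>s. ?t < s \<Longrightarrow> s < b \<Longrightarrow> Pt s \<notin> K"
        unfolding eventually_at_right_field by blast
      have "\<forall>\<^sub>F x in at_right 0. x \<in> {0<..<(b - ?t) * real N}"
        by (rule eventually_at_right_real) (use b(1) N_pos in simp)
      then show ?thesis
        using ivl_point_right[of k u]
      proof eventually_elim
        case (elim x)
        have "0 < x / real N" "x / real N < b - ?t"
          using elim(1) N_pos by (simp_all add: pos_divide_less_eq)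
        then have "Pt (ivl_point k (u + x)) \<notin> K" using elim(2) by (intro b(2)) simp_all
        then show ?case by (simp add: fibre_def J)
      qed
    qed (simp add: fibre_def)
  qed
qed

text \<open>
  Injectivity is fibrewise, and the finite partition exists because both \<open>h\<close> and the fibres of \<open>J\<close>
  are constant up to translation on each side of every point.
\<close>

lemma minimal_component_iem:
  assumes "minimal_component h J"
  shows "iem_on J h"
proof -
  note J01 = minimal_component_invariant(1)[OF assms]
  note hJ = minimal_component_invariant(2)[OF assms]
  interpret S: invariant_fibres L label_step \<rho> "fibre J"
    by (rule minimal_component_invariant(3)[OF assms])
  have "inj_on h J"
  proof (rule inj_onI)
    fix t t' assume t: "t \<in> J" "t' \<in> J" "h t = h t'"
    have t01: "0 \<le> t" "t < 1" "0 \<le> t'" "t' < 1" using t(1,2) J01 by auto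
    obtain k u where k: "k \<in> L" "0 \<le> u" "u < 1" "t = ivl_point k u"
      using t01(1,2) by (rule ivl_point_surj)
    obtain k' u' where k': "k' \<in> L" "0 \<le> u'" "u' < 1" "t' = ivl_point k' u'"
      using t01(3,4) by (rule ivl_point_surj)
    have "ivl_point (label_step u k) (u - \<rho>) = ivl_point (label_step u' k') (u' - \<rho>)"
      using t(3) k k' by (simp add: H_ivl_point)
    then have eq: "label_step u k = label_step u' k'" "frac (u - \<rho>) = frac (u' - \<rho>)"
      using ivl_point_inject[OF label_step_in label_step_in] by blast+
    have u: "u = u'" using frac_eq_shift[OF eq(2)] k(2,3) k'(2,3) by (simp add: frac_eq)
    moreover have "k = k'"
    proof (rule inj_onD[OF S.fibre_map_inj_on])
      show "label_step u k = label_step u k'" using eq(1) u by simp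
      show "k \<in> fibre J u" "k' \<in> fibre J u" using t(1,2) k k' u by (simp_all add: fibre_def)
    qed
    ultimately show "t = t'" using k k' by simp
  qed
  then have "bij_betw h J J" using hJ by (simp add: bij_betw_def)
  moreover have "translated_pieces h J"
    using J01
  proof (rule translated_pieces_from_local)
    fix t :: real assume t: "0 \<le> t" "t < 1"
    show "\<exists>e>0. {t..<t + e} \<inter> J = {} \<or> {t..<t + e} \<subseteq> J \<and> (\<exists>d. \<forall>t'\<in>{t..<t + e}. h t' = t' + d)"
    proof (rule right_neighbourhood[OF S.S_right_constant t])
      fix k u e d
      assume k: "k \<in> L" "0 < e"
        "\<And>t'. t \<le> t' \<Longrightarrow> t' < t + e \<Longrightarrow> \<exists>v. t' = ivl_point k v \<and> fibre J v = fibre J u"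
        "\<And>t'. t \<le> t' \<Longrightarrow> t' < t + e \<Longrightarrow> h t' = t' + d"
      have "t' \<in> J \<longleftrightarrow> k \<in> fibre J u" if "t' \<in> {t..<t + e}" for t'
        using k(3)[of t'] that ivl_point_in_iff[OF k(1)] by auto
      then show ?thesis
        using k(2,4) by (intro exI[of _ e]) (cases "k \<in> fibre J u"; auto)
    qed
  next
    fix t :: real assume t: "0 < t" "t \<le> 1"
    have limit: "\<exists>A. \<forall>\<^sub>F x in at_right 0. fibre J (u - x) = A" for u
      using S.S_one_sided_limit[of "-1" u] by simp
    show "\<exists>e>0. {t - e..<t} \<inter> J = {} \<or> {t - e..<t} \<subseteq> J \<and> (\<exists>d. \<forall>t'\<in>{t - e..<t}. h t' = t' + d)"
    proof (rule left_neighbourhood[OF limit t])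
      fix k A e d
      assume k: "k \<in> L" "0 < e"
        "\<And>t'. t - e \<le> t' \<Longrightarrow> t' < t \<Longrightarrow> \<exists>v. t' = ivl_point k v \<and> fibre J v = A"
        "\<And>t'. t - e \<le> t' \<Longrightarrow> t' < t \<Longrightarrow> h t' = t' + d"
      have "t' \<in> J \<longleftrightarrow> k \<in> A" if "t' \<in> {t - e..<t}" for t'
        using k(3)[of t'] that ivl_point_in_iff[OF k(1)] by auto
      then show ?thesis
        using k(2,4) by (intro exI[of _ e]) (cases "k \<in> A"; auto)
    qed
  qed
  ultimately show ?thesis unfolding iem_on_def translated_pieces_def by blast
qed

text \<open>
  A component is determined by its fibre over a single angle: an element of that fibre lies in only
  one component, and if the fibre is empty then so are all others.
\<close>

lemma finite_minimal_components: "finite {J. minimal_component h J}"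
proof (rule inj_on_finite)
  show "inj_on (\<lambda>J. fibre J 0) {J. minimal_component h J}"
  proof (rule inj_onI, clarify)
    fix J J' assume J: "minimal_component h J" "minimal_component h J'" and eq: "fibre J 0 = fibre J' 0"
    show "J = J'"
    proof (cases "fibre J 0 = {}")
      case True
      have "A = {}" if A: "minimal_component h A" "fibre A 0 = {}" for A
      proof (rule ccontr)
        interpret S: invariant_fibres L label_step \<rho> "fibre A"
          by (rule minimal_component_invariant(3)[OF A(1)])
        assume "A \<noteq> {}"
        then obtain t where t: "t \<in> A" by blast
        then have "0 \<le> t" "t < 1" using minimal_component_invariant(1)[OF A(1)] by auto
        then obtain k u where "k \<in> L" "t = ivl_point k u" by (rule ivl_point_surj)
        then have "k \<in> fibre A u" using t by (simp add: fibre_def)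
        moreover have "card (fibre A u) = 0" using S.card_constant[of u 0] A(2) by simp
        ultimately show False using S.finite_S by auto
      qed
      then show ?thesis using J eq True by metis
    next
      case False
      then obtain k where "ivl_point k 0 \<in> J" "ivl_point k 0 \<in> J'" using eq by (auto simp: fibre_def)
      then show ?thesis
        using J hat_minimal_component_unique unfolding minimal_component_def by blast
    qed
  qed
  show "(\<lambda>J. fibre J 0) ` {J. minimal_component h J} \<subseteq> Pow L" by (auto simp: fibre_def)
qed (simp add: finite_labels)

end

section \<open>Irrationality of the rotation angle\<close>

lemma rational_angle_root_of_unity:
  assumes "\<rho> \<in> \<rat>"
  obtains n where "1 \<le> n" "cis (2 * pi * \<rho>) ^ n = 1"
proof -
  obtain a b :: int where ab: "b > 0" "\<rho> = of_int a / of_int b"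
    using assms by (rule Rats_cases') blast
  have b: "real (nat b) = of_int b" using ab(1) by simp
  have "cis (2 * pi * \<rho>) ^ nat b = cis (real (nat b) * (2 * pi * \<rho>))" by (rule Complex.DeMoivre)
  also have "real (nat b) * (2 * pi * \<rho>) = 2 * pi * of_int a" using ab by (simp add: b)
  also have "cis (2 * pi * of_int a) = 1" by (simp add: cis_multiple_2pi)
  finally show thesis using ab(1) by (intro that[of "nat b"]) simp_all
qed

theorem theorem3p1:
  fixes T :: "real \<Rightarrow> real" and Iv :: "'a::finite \<Rightarrow> real set" and \<delta> :: "'a \<Rightarrow> real"
    and \<alpha> :: real and \<sigma> :: "'a \<Rightarrow> 'a list"
    and \<beta> :: complex and \<Gamma> :: "complex ^ 'a"
    and pos :: "'a label \<Rightarrow> nat"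
  assumes "iem T Iv \<delta>" and "minimal_iem T"
    and "self_similar T \<alpha>"
    and "associated_substitution T Iv \<alpha> \<sigma>" and "primitive_subst \<sigma>"
    and "cmod \<beta> > 1"
    and "\<forall>n\<ge>1. direction \<beta> ^ n \<noteq> 1"
    and "is_eigenvector (subst_matrix \<sigma>) \<beta> \<Gamma>"
    and "unique_representation \<sigma> \<beta> \<Gamma>"
    and "bij_betw pos (labels \<sigma>) {..<card (labels \<sigma>)}"
  shows "finite {J. minimal_component (H_ivl \<sigma> \<beta> \<Gamma> pos) J} \<and>
    (\<forall>J. minimal_component (H_ivl \<sigma> \<beta> \<Gamma> pos) J \<longrightarrow> iem_on J (H_ivl \<sigma> \<beta> \<Gamma> pos))"
proof -
  have nonempty: "\<And>a. \<sigma> a \<noteq> []"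
    using assms(4) by (simp add: associated_substitution_def)
  have "cmod (direction \<beta>) = 1" using assms(6) by (auto simp: direction_def norm_divide)
  then obtain \<rho> where \<rho>: "direction \<beta> = cis (2 * pi * \<rho>)" by (rule unit_complex_cis)
  have "\<rho> \<notin> \<rat>"
  proof
    assume "\<rho> \<in> \<rat>"
    then obtain n where "1 \<le> n" "cis (2 * pi * \<rho>) ^ n = 1" by (rule rational_angle_root_of_unity)
    then show False using assms(7) \<rho> by simp
  qed
  then interpret fractal_interval_map \<sigma> \<beta> \<Gamma> pos \<rho>
    using nonempty assms(6,9,10) \<rho> by unfold_locales
  show ?thesis using finite_minimal_components minimal_component_iem by blast
qed

end
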